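(* For every integer $p\ge2$, all $L_p,R>0$, every integer $N\ge1$, every dimension $d\ge 2N+2$, and every deterministic algorithm using at most $N$ feasible queries to the exact order-$p$ oracle on the public domain $B_2^d(R)$, there is an orthonormal frame $V=(v_1,\dots,v_m)$ in $\mathbb R^d$, $m=N+1$, such that the algorithm's (arbitrary feasible) output $\widehat x$ on the operator $F_V$ obeys $$r_{\mathrm{tan}}(\widehat x)\ge\frac{\lambda R}{8m}=\frac{L_pR^p}{8B_p16^{p-1}m^{(3p-1)/2}} .$$ In particular, with $D=2R$, in the high-dimensional worst-case model, $$\mathsf T_p^{\mathrm{det}}(\varepsilon;L_p,D)=\Omega_p\!\left((L_pD^p/\varepsilon)^{2/(3p-1)}\right),$$ i.e. there are $c_p>0$ and $Q_p$ depending only on $p$ such that $\mathsf T_p^{\mathrm{det}}(\varepsilon;L_p,D)\ge c_p(L_pD^p/\varepsilon)^{2/(3p-1)}$ whenever $L_pD^p/\varepsilon\ge Q_p$.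
   Context: Hard family. Fix once and for all an even $C^\infty$ function $\rho:\mathbb R\to[0,1]$ with $\rho(u)=0$ for $|u|\le1/2$ and $\rho(u)=1$ for $|u|\ge1$. Put $B_p=\max\{1,\|\rho^{(p-1)}\|_\infty\}$ and, for $\tau>0$, $h_\tau(s)=\tau\int_0^{s/\tau}\rho(u)\,du$. For $N\ge1$, $m=N+1$: $q=1-\frac1{2m}$, $c=\frac{R}{2\sqrt m}$, $\tau=\frac{c}{8m}=\frac{R}{16m^{3/2}}$, $\lambda=\frac{L_p\tau^{p-1}}{B_p}$. For an orthonormal frame $V=(v_1,\dots,v_m)$ in $\mathbb R^d$, $$T_V(x)=cv_1+q\sum_{i=1}^{m-1}h_\tau(\langle v_i,x\rangle)v_{i+1},\qquad F_V(x)=\lambda(x-T_V(x)).$$ The public domain is the closed ball $\mathcal X=B_2^d(R)=\{x\in\mathbb R^d:\|x\|\le R\}$ with public initial point $x_0=0$; everything except the frame $V$ may be known to the algorithm. $N_{\mathcal X}(x)=\{n:\langle n,z-x\rangle\le0\ \forall z\in\mathcal X\}$, $r_{\mathrm{tan}}(x)=\operatorname{dist}(0,F(x)+N_{\mathcal X}(x))$ (with $F=F_V$ in the first claim). Oracle and algorithms. A query at $x\in\mathcal X$ returns $(F(x),DF(x),\dots,D^{p-1}F(x))$. A deterministic algorithm chooses each feasible query point as a (measurable, everywhere defined) function of the previous queries and answers, and outputs a feasible point as a function of the complete transcript; the output need not have been queried, and there is no span or update restriction. Complexity. For a compact convex $\mathcal X\subset\mathbb R^d$, $\mathfrak F_{p,L_p}(\mathcal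 X)$ is the set of operators $F$, $C^{p-1}$ on an open neighborhood of $\mathcal X$, monotone on $\mathcal X$, with $\|D^{p-1}F(x)-D^{p-1}F(y)\|_{\mathrm{op}}\le L_p\|x-y\|$ on $\mathcal X$. $\mathsf T_p^{\mathrm{det}}(\varepsilon;L_p,D)$ is the least $N\in\mathbb N_0$ such that for every finite $d$, every nonempty compact convex $\mathcal X\subset\mathbb R^d$ with $\operatorname{diam}\mathcal X\le D$, and every $x_0\in\mathcal X$ there is a deterministic algorithm (knowing $d,\mathcal X,x_0,p,L_p,D,\varepsilon$) with at most $N$ queries whose output satisfies $r_{\mathrm{tan}}(\widehat x)\le\varepsilon$ for every $F\in\mathfrak F_{p,L_p}(\mathcal X)$ ($+\infty$ if none). *)

theory Defs
  imports "HOL-Analysis.Analysis"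
begin

section \<open>Euclidean spaces of all finite dimensions\<close>

text \<open>
  The complexity below quantifies over the dimension \<open>d\<close> inside a formula, so \<open>d\<close> cannot be the
  cardinality of an index type.  All the spaces \<open>\<real>\<^sup>d\<close> are therefore realised as the
  subspaces \<open>Rd d\<close> of one real inner product space, the finitely supported real sequences with the
  Euclidean inner product.  Norm, topology, derivatives (\<open>at x within Rd d\<close>) etc. are the library's.
\<close>

typedef fseq = "{f :: nat \<Rightarrow> real. finite {i. f i \<noteq> 0}}"
  morphisms coord Abs_fseq
  by (rule exI[of _ "\<lambda>_. 0"]) simp

lemma finite_coord [simp]: "finite {i. coord x i \<noteq> 0}"
  using coord[of x] by simp

lemma coord_Abs_fseq: "finite {i. f i \<noteq> 0} \<Longrightarrow> coord (Abs_fseq f) = f"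
  by (simp add: Abs_fseq_inverse)

lemma fseq_eqI: "(\<And>i. coord x i = coord y i) \<Longrightarrow> x = y"
  by (metis coord_inject ext)

instantiation fseq :: real_vector
begin

definition "0 = Abs_fseq (\<lambda>_. 0)"
definition "x + y = Abs_fseq (\<lambda>i. coord x i + coord y i)"
definition "x - y = Abs_fseq (\<lambda>i. coord x i - coord y i)"
definition "- x = Abs_fseq (\<lambda>i. - coord x i)"
definition "a *\<^sub>R x = Abs_fseq (\<lambda>i. a * coord x i)"

lemma coord_zero [simp]: "coord 0 i = 0"
  by (simp add: zero_fseq_def coord_Abs_fseq)

lemma coord_add [simp]: "coord (x + y) i = coord x i + coord y i"
proof -
  have "finite {i. coord x i + coord y i \<noteq> 0}"
    by (rule finite_subset[of _ "{i. coord x i \<noteq> 0} \<union> {i. coord y i \<noteq> 0}"]) auto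
  then show ?thesis by (simp add: plus_fseq_def coord_Abs_fseq)
qed

lemma coord_diff [simp]: "coord (x - y) i = coord x i - coord y i"
proof -
  have "finite {i. coord x i - coord y i \<noteq> 0}"
    by (rule finite_subset[of _ "{i. coord x i \<noteq> 0} \<union> {i. coord y i \<noteq> 0}"]) auto
  then show ?thesis by (simp add: minus_fseq_def coord_Abs_fseq)
qed

lemma coord_uminus [simp]: "coord (- x) i = - coord x i"
  by (simp add: uminus_fseq_def coord_Abs_fseq)

lemma coord_scaleR [simp]: "coord (a *\<^sub>R x) i = a * coord x i"
proof -
  have "finite {i. a * coord x i \<noteq> 0}"
    by (rule finite_subset[of _ "{i. coord x i \<noteq> 0}"]) auto
  then show ?thesis by (simp add: scaleR_fseq_def coord_Abs_fseq)
qed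

instance
  by standard (auto intro!: fseq_eqI simp: algebra_simps)

end

instantiation fseq :: real_inner
begin

definition "inner x y = (\<Sum>i | coord x i \<noteq> 0. coord x i * coord y i)"
definition "norm (x :: fseq) = sqrt (inner x x)"
definition "dist (x :: fseq) y = norm (x - y)"
definition "sgn (x :: fseq) = x /\<^sub>R norm x"
definition "uniformity = (INF e\<in>{0<..}. principal {(x :: fseq, y). dist x y < e})"
definition "open (U :: fseq set) \<longleftrightarrow> (\<forall>x\<in>U. \<forall>\<^sub>F (x', y) in uniformity. x' = x \<longrightarrow> y \<in> U)"

lemma inner_fseq_eq:
  assumes "finite A" "{i. coord x i \<noteq> 0} \<subseteq> A"
  shows "inner x y = (\<Sum>i\<in>A. coord x i * coord y i)"
  unfolding inner_fseq_def using assms by (intro sum.mono_neutral_left) auto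

instance
proof
  fix x y z :: fseq and r :: real
  let ?A = "{i. coord x i \<noteq> 0} \<union> {i. coord y i \<noteq> 0}"
  show "inner x y = inner y x"
    by (simp add: inner_fseq_eq[of ?A] mult.commute)
  have "{i. coord (x + y) i \<noteq> 0} \<subseteq> ?A" by auto
  then show "inner (x + y) z = inner x z + inner y z"
    by (simp add: inner_fseq_eq[of ?A] sum.distrib algebra_simps)
  have "{i. coord (r *\<^sub>R x) i \<noteq> 0} \<subseteq> {i. coord x i \<noteq> 0}" by auto
  then show "inner (r *\<^sub>R x) y = r * inner x y"
    by (simp add: inner_fseq_eq[of "{i. coord x i \<noteq> 0}"] sum_distrib_left algebra_simps)
  show "0 \<le> inner x x"
    by (simp add: inner_fseq_def sum_nonneg)
  show "inner x x = 0 \<longleftrightarrow> x = 0"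
    by (auto simp: inner_fseq_def sum_nonneg_eq_0_iff intro: fseq_eqI)
qed (simp_all add: norm_fseq_def dist_fseq_def sgn_fseq_def uniformity_fseq_def open_fseq_def)

end

definition Rd :: "nat \<Rightarrow> fseq set" where
  "Rd d = {x. \<forall>i\<ge>d. coord x i = 0}"

definition Bd :: "nat \<Rightarrow> real \<Rightarrow> fseq set" where
  "Bd d R = cball 0 R \<inter> Rd d"

section \<open>Higher derivatives on \<open>\<real>\<^sup>d\<close>\<close>

text \<open>
  \<open>nderiv d F [u\<^sub>1, \<dots>, u\<^sub>k] x\<close> is \<open>D\<^sup>kF(x)[u\<^sub>1, \<dots>, u\<^sub>k]\<close>.  A Frechet derivative within \<open>Rd d\<close> is unique
  on \<open>Rd d\<close> only, so this is meaningful for directions in \<open>Rd d\<close>; it is used for these only.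
\<close>

primrec nderiv :: "nat \<Rightarrow> (fseq \<Rightarrow> fseq) \<Rightarrow> fseq list \<Rightarrow> fseq \<Rightarrow> fseq" where
  "nderiv d F [] = F"
| "nderiv d F (u # us) = (\<lambda>x. frechet_derivative (nderiv d F us) (at x within Rd d) u)"

definition tuples :: "nat \<Rightarrow> nat \<Rightarrow> fseq list set" where
  "tuples d k = {us. length us = k \<and> set us \<subseteq> Rd d}"

text \<open>
  \<open>C\<^sup>k\<close> on a relatively open \<open>U \<subseteq> Rd d\<close>.  In finite dimension, differentiability and continuity of
  \<open>x \<mapsto> D\<^sup>jF(x)\<close> as a map into \<open>j\<close>-linear maps is differentiability and continuity of its evaluations.
\<close>

definition Ck_on :: "nat \<Rightarrow> nat \<Rightarrow> fseq set \<Rightarrow> (fseq \<Rightarrow> fseq) \<Rightarrow> bool" where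
  "Ck_on d k U F \<longleftrightarrow>
     (\<forall>j<k. \<forall>us\<in>tuples d j. \<forall>x\<in>U. nderiv d F us differentiable (at x within Rd d)) \<and>
     (\<forall>j\<le>k. \<forall>us\<in>tuples d j. continuous_on U (nderiv d F us))"

definition mlin_opnorm :: "nat \<Rightarrow> nat \<Rightarrow> (fseq list \<Rightarrow> fseq) \<Rightarrow> real" where
  "mlin_opnorm d k M = (SUP us\<in>{us \<in> tuples d k. \<forall>u\<in>set us. norm u \<le> 1}. norm (M us))"

section \<open>Operator class and tangent residual\<close>

definition monotone_operator_on :: "fseq set \<Rightarrow> (fseq \<Rightarrow> fseq) \<Rightarrow> bool" where
  "monotone_operator_on X F \<longleftrightarrow> (\<forall>x\<in>X. \<forall>y\<in>X. 0 \<le> (F x - F y) \<bullet> (x - y))"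

definition op_class :: "nat \<Rightarrow> nat \<Rightarrow> real \<Rightarrow> fseq set \<Rightarrow> (fseq \<Rightarrow> fseq) set" where
  "op_class d p L X = {F.
     (\<exists>U. openin (top_of_set (Rd d)) U \<and> X \<subseteq> U \<and> F \<in> U \<rightarrow> Rd d \<and> Ck_on d (p - 1) U F) \<and>
     monotone_operator_on X F \<and>
     (\<forall>x\<in>X. \<forall>y\<in>X.
        mlin_opnorm d (p - 1) (\<lambda>us. nderiv d F us x - nderiv d F us y) \<le> L * norm (x - y))}"

definition normal_cone :: "nat \<Rightarrow> fseq set \<Rightarrow> fseq \<Rightarrow> fseq set" where
  "normal_cone d X x = {n \<in> Rd d. \<forall>z\<in>X. n \<bullet> (z - x) \<le> 0}"

definition r_tan :: "nat \<Rightarrow> fseq set \<Rightarrow> (fseq \<Rightarrow> fseq) \<Rightarrow> fseq \<Rightarrow> real" where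
  "r_tan d X F x = infdist 0 ((\<lambda>n. F x + n) ` normal_cone d X x)"

section \<open>Oracle and deterministic algorithms\<close>

text \<open>
  The answer at \<open>x\<close> is the tuple \<open>(F(x), DF(x), \<dots>, D\<^sup>p\<^sup>-\<^sup>1F(x))\<close>, indexed by \<open>k < p\<close>; entry \<open>k\<close> is a
  \<open>k\<close>-linear map on \<open>Rd d\<close>, extended by \<open>undefined\<close> so that nothing else is revealed.
  The space of \<open>k\<close>-linear maps carries the sigma-algebra generated by the evaluations, which is the
  Borel one, as this space is finite-dimensional.
\<close>

type_synonym answer = "nat \<Rightarrow> fseq list \<Rightarrow> fseq"
type_synonym transcript = "nat \<Rightarrow> fseq \<times> answer"

definition oracle_answer :: "nat \<Rightarrow> nat \<Rightarrow> (fseq \<Rightarrow> fseq) \<Rightarrow> fseq \<Rightarrow> answer" where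
  "oracle_answer d p F x = (\<lambda>k\<in>{..<p}. \<lambda>us\<in>tuples d k. nderiv d F us x)"

definition mlin_maps :: "nat \<Rightarrow> nat \<Rightarrow> (fseq list \<Rightarrow> fseq) set" where
  "mlin_maps d k = {M \<in> tuples d k \<rightarrow>\<^sub>E Rd d.
     \<forall>us\<in>tuples d k. \<forall>i<k. \<forall>u\<in>Rd d. \<forall>v\<in>Rd d. \<forall>a b.
       M (us[i := a *\<^sub>R u + b *\<^sub>R v]) = a *\<^sub>R M (us[i := u]) + b *\<^sub>R M (us[i := v])}"

definition mlin_space :: "nat \<Rightarrow> nat \<Rightarrow> (fseq list \<Rightarrow> fseq) measure" where
  "mlin_space d k = restrict_space (\<Pi>\<^sub>M us\<in>tuples d k. borel) (mlin_maps d k)"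

definition answer_space :: "nat \<Rightarrow> nat \<Rightarrow> answer measure" where
  "answer_space d p = (\<Pi>\<^sub>M k\<in>{..<p}. mlin_space d k)"

definition transcript_space :: "nat \<Rightarrow> nat \<Rightarrow> fseq set \<Rightarrow> nat \<Rightarrow> transcript measure" where
  "transcript_space d p X t =
     (\<Pi>\<^sub>M i\<in>{..<t}. restrict_space borel X \<Otimes>\<^sub>M answer_space d p)"

text \<open>
  A deterministic algorithm with \<open>n\<close> queries: \<open>Q t\<close> yields the query point number \<open>t\<close> (from 0) from
  the first \<open>t\<close> queries and answers, \<open>out\<close> the output from all \<open>n\<close> of them.  Measurability into
  \<open>restrict_space borel X\<close> includes feasibility on all transcripts.
\<close>

definition det_algorithm ::
  "nat \<Rightarrow> nat \<Rightarrow> fseq set \<Rightarrow> nat \<Rightarrow> (nat \<Rightarrow> transcript \<Rightarrow> fseq) \<Rightarrow> (transcript \<Rightarrow> fseq) \<Rightarrow> bool" where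
  "det_algorithm d p X n Q out \<longleftrightarrow>
     (\<forall>t<n. Q t \<in> transcript_space d p X t \<rightarrow>\<^sub>M restrict_space borel X) \<and>
     out \<in> transcript_space d p X n \<rightarrow>\<^sub>M restrict_space borel X"

primrec run :: "nat \<Rightarrow> nat \<Rightarrow> (fseq \<Rightarrow> fseq) \<Rightarrow> (nat \<Rightarrow> transcript \<Rightarrow> fseq) \<Rightarrow> nat \<Rightarrow> transcript" where
  "run d p F Q 0 = (\<lambda>_. undefined)"
| "run d p F Q (Suc t) =
     (let h = run d p F Q t; x = Q t h in h(t := (x, oracle_answer d p F x)))"

definition T_det :: "nat \<Rightarrow> real \<Rightarrow> real \<Rightarrow> real \<Rightarrow> enat" where
  "T_det p \<epsilon> L D = Inf {enat N | N.
     \<forall>d X x0. X \<subseteq> Rd d \<and> X \<noteq> {} \<and> compact X \<and> convex X \<and> diameter X \<le> D \<and> x0 \<in> X \<longrightarrow>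
       (\<exists>n\<le>N. \<exists>Q out. det_algorithm d p X n Q out \<and>
          (\<forall>F\<in>op_class d p L X. r_tan d X F (out (run d p F Q n)) \<le> \<epsilon>))}"

section \<open>The hard family\<close>

definition smooth_cutoff :: "(real \<Rightarrow> real) \<Rightarrow> bool" where
  "smooth_cutoff \<rho> \<longleftrightarrow>
     (\<forall>k. (deriv ^^ k) \<rho> differentiable_on UNIV) \<and>
     (\<forall>u. \<rho> (- u) = \<rho> u) \<and> (\<forall>u. \<rho> u \<in> {0..1}) \<and>
     (\<forall>u. \<bar>u\<bar> \<le> 1/2 \<longrightarrow> \<rho> u = 0) \<and> (\<forall>u. 1 \<le> \<bar>u\<bar> \<longrightarrow> \<rho> u = 1)"

definition B_const :: "(real \<Rightarrow> real) \<Rightarrow> nat \<Rightarrow> real" where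
  "B_const \<rho> p = max 1 (SUP u. \<bar>(deriv ^^ (p - 1)) \<rho> u\<bar>)"

definition h_fun :: "(real \<Rightarrow> real) \<Rightarrow> real \<Rightarrow> real \<Rightarrow> real" where
  "h_fun \<rho> \<tau> s = \<tau> * (LBINT u=0..ereal (s / \<tau>). \<rho> u)"

text \<open>In the following parameters \<open>m = N + 1\<close>.\<close>

definition q_par :: "nat \<Rightarrow> real" where
  "q_par N = 1 - 1 / (2 * real (N + 1))"

definition c_par :: "real \<Rightarrow> nat \<Rightarrow> real" where
  "c_par R N = R / (2 * sqrt (real (N + 1)))"

definition tau_par :: "real \<Rightarrow> nat \<Rightarrow> real" where
  "tau_par R N = c_par R N / (8 * real (N + 1))"

definition lam_par :: "(real \<Rightarrow> real) \<Rightarrow> nat \<Rightarrow> real \<Rightarrow> real \<Rightarrow> nat \<Rightarrow> real" where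
  "lam_par \<rho> p L R N = L * tau_par R N ^ (p - 1) / B_const \<rho> p"

definition orthonormal_frame :: "nat \<Rightarrow> nat \<Rightarrow> (nat \<Rightarrow> fseq) \<Rightarrow> bool" where
  "orthonormal_frame d m V \<longleftrightarrow>
     (\<forall>i\<in>{1..m}. V i \<in> Rd d) \<and>
     (\<forall>i\<in>{1..m}. \<forall>j\<in>{1..m}. V i \<bullet> V j = (if i = j then 1 else 0))"

definition T_op :: "(real \<Rightarrow> real) \<Rightarrow> real \<Rightarrow> nat \<Rightarrow> (nat \<Rightarrow> fseq) \<Rightarrow> fseq \<Rightarrow> fseq" where
  "T_op \<rho> R N V x = c_par R N *\<^sub>R V 1 +
     q_par N *\<^sub>R (\<Sum>i = 1..N. h_fun \<rho> (tau_par R N) (V i \<bullet> x) *\<^sub>R V (i + 1))"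

definition F_op ::
  "(real \<Rightarrow> real) \<Rightarrow> nat \<Rightarrow> real \<Rightarrow> real \<Rightarrow> nat \<Rightarrow> (nat \<Rightarrow> fseq) \<Rightarrow> fseq \<Rightarrow> fseq" where
  "F_op \<rho> p L R N V x = lam_par \<rho> p L R N *\<^sub>R (x - T_op \<rho> R N V x)"

end

theory Submission
  imports Defs
begin

text \<open>
  Through \<open>h\<^sub>\<tau>\<close>, which vanishes near \<open>0\<close>, the chain \<open>T\<close> passes information from \<open>v\<^sub>i\<close> to \<open>v\<^sub>i\<^sub>+\<^sub>1\<close> only at points
  that correlate with \<open>v\<^sub>i\<close>, so a frame can be built along the run of the algorithm in which each query
  reveals one vector, and the output is orthogonal to the last vector \<open>v\<^sub>m\<close>.  Such a point has a large
  residual: in the interior of the ball a small displacement \<open>x - T x\<close> would force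
  \<open>\<langle>v\<^sub>m, x\<rangle> \<approx> q\<^sup>m\<^sup>-\<^sup>1 c > 0\<close>, and on the sphere \<open>\<langle>F x + n, x\<rangle> \<ge> \<lambda> R (R - \<parallel>T x\<parallel>)\<close>, where \<open>T\<close> maps
  the ball into a smaller one.
\<close>

section \<open>Existence of a smooth cutoff\<close>

text \<open>The algorithm obeys no span restriction and may output an unqueried point, so a fixed
  frame cannot be hidden from it; the vectors must be chosen after the points they have to avoid.
  The oracle also shows derivatives, so the whole jet of \<open>h_fun\<close> at 0 has to vanish;
  the plateau of the cutoff provides this. Step \<open>t\<close> needs a unit vector orthogonal to
  \<open>t\<close> frame vectors and \<open>t + 1\<close> points, which is possible once
  \<open>2 * t + 2 \<le> d\<close>; \<open>t = N\<close> gives the dimension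
  \<open>2 * N + 2\<close>. With m = N + 1, the parameters balance two needs. In the chain, q = 1 -
  1/(2m) lets N damped links keep half of c, and \<tau> = c/(8m) bounds the total loss in the
  plateaus by c/8. On the sphere, c of order R / sqrt m is as large as c^2 + q^2 R^2 < R^2 permits.
  Both cases then yield a displacement of R/(8m). Finally \<lambda> cancels the factor B /
  \<tau>^(p-1) in the Lipschitz constant of the top derivative, so the exponent is 3(p-1)/2 from
  \<tau> plus 1 from the displacement. The complexity claim mentions no cutoff, so one has to be
  constructed; choosing it before L, D and \<epsilon> makes the constants depend on p alone.\<close>

definition flat :: "nat \<Rightarrow> real \<Rightarrow> real" where
  "flat k x = (if x \<le> 0 then 0 else (1 / x) ^ k * exp (- (1 / x)))"

lemma flat_nonneg: "0 \<le> flat k x"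
  by (simp add: flat_def)

lemma flat_pos: "0 < x \<Longrightarrow> 0 < flat k x"
  by (simp add: flat_def)

lemma flat_tendsto_0: "((\<lambda>x. flat k x) \<longlongrightarrow> 0) (at 0)"
proof -
  have "((\<lambda>y. y ^ k / exp y) \<longlongrightarrow> 0) (at_top :: real filter)"
    by (rule tendsto_power_div_exp_0)
  then have "((\<lambda>x. inverse x ^ k / exp (inverse x)) \<longlongrightarrow> 0) (at_right (0::real))"
    by (rule filterlim_compose[OF _ filterlim_inverse_at_top_right])
  then have r: "(flat k \<longlongrightarrow> 0) (at_right 0)"
    by (rule Lim_transform_eventually)
      (auto simp: eventually_at_filter flat_def exp_minus field_simps)
  have "\<forall>\<^sub>F x in at_left 0. 0 = flat k x"
    by (simp add: eventually_at_filter flat_def)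
  then have l: "(flat k \<longlongrightarrow> 0) (at_left 0)"
    by (rule Lim_transform_eventually[OF tendsto_const])
  show ?thesis using l r by (simp add: filterlim_at_split)
qed

lemma flat_has_derivative:
  "(flat k has_real_derivative flat (k + 2) x - real k * flat (k + 1) x) (at x)"
proof -
  consider "x < 0" | "x = 0" | "0 < x" by linarith
  then show ?thesis
  proof cases
    case 1
    have "((\<lambda>_. 0) has_real_derivative 0) (at x)" by simp
    then have "(flat k has_real_derivative 0) (at x)"
      by (rule has_field_derivative_transform_within_open[of _ _ _ "{..<0}"])
        (use 1 in \<open>auto simp: flat_def\<close>)
    then show ?thesis using 1 by (simp add: flat_def)
  next
    case 2
    \<comment> \<open>The difference quotient at 0 is the next member of the family, so its limit is
      already known.\<close>
    have "(flat k y - flat k 0) / (y - 0) = flat (Suc k) y" for y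
      by (simp add: flat_def)
    then have "((\<lambda>y. (flat k y - flat k 0) / (y - 0)) \<longlongrightarrow> 0) (at 0)"
      using flat_tendsto_0[of "Suc k"] by simp
    then show ?thesis using 2 by (simp add: has_field_derivative_iff flat_def)
  next
    case 3
    have "((\<lambda>x. (1 / x) ^ k * exp (- (1 / x))) has_real_derivative
        (flat (k + 2) x - real k * flat (k + 1) x)) (at x)"
      \<comment> \<open>The power rule produces the truncated exponent \<open>k - 1\<close>, hence
        the case split on \<open>k\<close>.\<close>
      using 3 by (auto intro!: derivative_eq_intros simp: flat_def)
       (cases k; simp add: field_simps power2_eq_square)
    then show ?thesis
      by (rule has_field_derivative_transform_within_open[of _ _ _ "{0<..}"])
        (use 3 in \<open>auto simp: flat_def\<close>)
  qed
qed

text \<open>The powers of \<open>1 / x\<close> in \<^const>\<open>flat\<close> make this class closed under differentiation.\<close>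

inductive smooth_term :: "(real \<Rightarrow> real) \<Rightarrow> bool" where
  const: "smooth_term (\<lambda>_. c)"
| ident: "smooth_term (\<lambda>x. x)"
| flat: "smooth_term (flat k)"
| add: "smooth_term f \<Longrightarrow> smooth_term g \<Longrightarrow> smooth_term (\<lambda>x. f x + g x)"
| mult: "smooth_term f \<Longrightarrow> smooth_term g \<Longrightarrow> smooth_term (\<lambda>x. f x * g x)"
| compose: "smooth_term f \<Longrightarrow> smooth_term g \<Longrightarrow> smooth_term (\<lambda>x. f (g x))"
| inverse: "smooth_term f \<Longrightarrow> (\<And>x. f x \<noteq> 0) \<Longrightarrow> smooth_term (\<lambda>x. inverse (f x))"

lemma smooth_term_diff:
  assumes "smooth_term f" "smooth_term g" shows "smooth_term (\<lambda>x. f x - g x)"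
  using smooth_term.add[OF assms(1) smooth_term.mult[OF smooth_term.const[of "- 1"] assms(2)]]
  by simp

text \<open>The derivative is found inside the same class, so the statement can be iterated to all
  orders.\<close>

lemma smooth_term_has_derivative:
  "smooth_term f \<Longrightarrow> \<exists>g. smooth_term g \<and> (\<forall>x. (f has_real_derivative g x) (at x))"
proof (induction rule: smooth_term.induct)
  case (const c)
  then show ?case by (intro exI[of _ "\<lambda>_. 0"]) (auto intro: smooth_term.const)
next
  case ident
  then show ?case by (intro exI[of _ "\<lambda>_. 1"]) (auto intro: smooth_term.const)
next
  case (flat k)
  show ?case
    by (rule exI[of _ "\<lambda>x. flat (k + 2) x - real k * flat (k + 1) x"])
      (intro conjI allI flat_has_derivative smooth_term_diff smooth_term.mult smooth_term.const
        smooth_term.flat)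
next
  case (add f g)
  then obtain f' g' where "smooth_term f'" "smooth_term g'"
    "\<And>x. (f has_real_derivative f' x) (at x)" "\<And>x. (g has_real_derivative g' x) (at x)" by blast
  then show ?case
    by (intro exI[of _ "\<lambda>x. f' x + g' x"] conjI allI smooth_term.add DERIV_add) auto
next
  case (mult f g)
  then obtain f' g' where "smooth_term f'" "smooth_term g'"
    "\<And>x. (f has_real_derivative f' x) (at x)" "\<And>x. (g has_real_derivative g' x) (at x)" by blast
  then show ?case using mult.hyps
    by (intro exI[of _ "\<lambda>x. f' x * g x + g' x * f x"] conjI allI smooth_term.add smooth_term.mult
        DERIV_mult) auto
next
  case (compose f g)
  then obtain f' g' where "smooth_term f'" "smooth_term g'"
    "\<And>x. (f has_real_derivative f' x) (at x)" "\<And>x. (g has_real_derivative g' x) (at x)" by blast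
  then show ?case using compose.hyps
    by (intro exI[of _ "\<lambda>x. f' (g x) * g' x"] conjI allI smooth_term.mult
        DERIV_chain2[where f = f and g = g] smooth_term.compose[of f' g]) auto
next
  case (inverse f)
  then obtain f' where f': "smooth_term f'" "\<And>x. (f has_real_derivative f' x) (at x)" by blast
  have "smooth_term (\<lambda>x. - 1 * (inverse (f x) * f' x * inverse (f x)))"
    by (intro smooth_term.mult smooth_term.const smooth_term.inverse f' inverse.hyps)
  moreover have "((\<lambda>x. inverse (f x)) has_real_derivative
      - 1 * (inverse (f x) * f' x * inverse (f x))) (at x)" for x
    using DERIV_inverse'[OF f'(2) inverse.hyps(2), of x] by simp
  ultimately show ?case by blast
qed

lemma smooth_term_higher_deriv: "smooth_term f \<Longrightarrow> smooth_term ((deriv ^^ k) f)"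
proof (induction k)
  case (Suc k)
  then obtain g where g: "smooth_term g" "\<And>x. ((deriv ^^ k) f has_real_derivative g x) (at x)"
    using smooth_term_has_derivative by blast
  have "deriv ((deriv ^^ k) f) = g" using g(2) DERIV_imp_deriv by blast
  then show ?case using g(1) by simp
qed simp

text \<open>The quotient a / (a + b), where a vanishes exactly for u^2 \<le> 1/4 and b exactly for
  u^2 \<ge> 1. They never vanish together, so the denominator is positive. Using u^2 instead of
  \<bar>u\<bar> gives evenness and keeps smoothness.\<close>

lemma smooth_cutoff_exists: "\<exists>\<rho>. smooth_cutoff \<rho>"
proof -
  define a where "a u = flat 0 (u * u - 1 / 4)" for u :: real
  define b where "b u = flat 0 (1 - u * u)" for u :: real
  have nonneg: "0 \<le> a u" "0 \<le> b u" for u by (simp_all add: a_def b_def flat_nonneg)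
  have pos: "0 < a u + b u" for u
  proof (cases "u * u \<le> 1 / 4")
    case True
    then have "0 < b u" unfolding b_def by (intro flat_pos) linarith
    then show ?thesis using nonneg[of u] by linarith
  next
    case False
    then have "0 < a u" unfolding a_def by (intro flat_pos) linarith
    then show ?thesis using nonneg[of u] by linarith
  qed
  have "smooth_term a" "smooth_term b"
    unfolding a_def b_def
    by (intro smooth_term.compose[OF smooth_term.flat] smooth_term_diff smooth_term.mult
        smooth_term.const smooth_term.ident)+
  then have sm: "smooth_term (\<lambda>u. a u * inverse (a u + b u))"
    using pos by (intro smooth_term.mult smooth_term.inverse smooth_term.add)
      (auto simp: less_le)
  define \<rho> where "\<rho> = (\<lambda>u. a u * inverse (a u + b u))"
  have "(deriv ^^ k) \<rho> differentiable_on UNIV" for k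
    using smooth_term_has_derivative[OF smooth_term_higher_deriv[OF sm, of k]]
    unfolding \<rho>_def differentiable_on_def
    by (meson has_field_derivative_imp_has_derivative differentiableI)
  moreover have "\<rho> (- u) = \<rho> u" for u by (simp add: \<rho>_def a_def b_def)
  moreover have "\<rho> u \<in> {0..1}" for u
    using pos[of u] nonneg[of u] by (auto simp: \<rho>_def field_simps)
  moreover have "\<rho> u = 0" if "\<bar>u\<bar> \<le> 1 / 2" for u
  proof -
    have "u * u \<le> 1 / 4" using abs_le_square_iff[of u "1/2"] that by (simp add: power2_eq_square)
    then show ?thesis by (simp add: \<rho>_def a_def flat_def)
  qed
  moreover have "\<rho> u = 1" if "1 \<le> \<bar>u\<bar>" for u
  proof -
    have "1 \<le> u * u" using abs_le_square_iff[of 1 u] that by (simp add: power2_eq_square)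
    then have "b u = 0" by (simp add: b_def flat_def)
    then show ?thesis using pos[of u] by (simp add: \<rho>_def)
  qed
  ultimately have "smooth_cutoff \<rho>" unfolding smooth_cutoff_def by blast
  then show ?thesis by blast
qed

section \<open>The scalar function \<open>h\<^sub>\<tau>\<close>\<close>

lemma smooth_cutoffD:
  assumes "smooth_cutoff \<rho>"
  shows "0 \<le> \<rho> u" "\<rho> u \<le> 1" "\<bar>u\<bar> \<le> 1/2 \<Longrightarrow> \<rho> u = 0" "1 \<le> \<bar>u\<bar> \<Longrightarrow> \<rho> u = 1"
proof -
  have *: "\<forall>u. \<rho> u \<in> {0..1}" "\<forall>u. \<bar>u\<bar> \<le> 1/2 \<longrightarrow> \<rho> u = 0" "\<forall>u. 1 \<le> \<bar>u\<bar> \<longrightarrow> \<rho> u = 1"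
    using assms unfolding smooth_cutoff_def by blast+
  show "0 \<le> \<rho> u" "\<rho> u \<le> 1" "\<bar>u\<bar> \<le> 1/2 \<Longrightarrow> \<rho> u = 0" "1 \<le> \<bar>u\<bar> \<Longrightarrow> \<rho> u = 1"
    using *(1)[rule_format, of u] *(2)[rule_format, of u] *(3)[rule_format, of u] by auto
qed

lemma smooth_cutoff_has_deriv:
  assumes "smooth_cutoff \<rho>"
  shows "((deriv ^^ k) \<rho> has_real_derivative (deriv ^^ Suc k) \<rho> u) (at u)"
proof -
  have "\<forall>k. (deriv ^^ k) \<rho> differentiable_on UNIV"
    using assms unfolding smooth_cutoff_def by blast
  then have "(deriv ^^ k) \<rho> differentiable (at u)"
    by (simp add: differentiable_on_def)
  then have "(deriv ^^ k) \<rho> field_differentiable (at u)"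
    by (simp add: real_differentiable_def field_differentiable_def)
  then show ?thesis by (simp add: field_differentiable_derivI)
qed

text \<open>Reduces boundedness of a derivative on the line to a compact interval. The strict
  inequality describes an open set, so that the constancy can be differentiated again.\<close>

lemma smooth_cutoff_deriv_outside:
  assumes "smooth_cutoff \<rho>"
  shows "\<exists>c. \<forall>u. 1 < \<bar>u\<bar> \<longrightarrow> (deriv ^^ k) \<rho> u = c"
proof (induction k)
  case 0
  then show ?case using smooth_cutoffD(4)[OF assms] by (intro exI[of _ 1]) simp
next
  case (Suc k)
  then obtain c where c: "\<And>u. 1 < \<bar>u\<bar> \<Longrightarrow> (deriv ^^ k) \<rho> u = c" by blast
  have op: "open {u :: real. 1 < \<bar>u\<bar>}" by (intro open_Collect_less continuous_intros)
  have "(deriv ^^ Suc k) \<rho> u = 0" if u: "1 < \<bar>u\<bar>" for u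
  proof -
    have "((\<lambda>_. c) has_real_derivative (deriv ^^ Suc k) \<rho> u) (at u)"
      by (rule has_field_derivative_transform_within_open[OF smooth_cutoff_has_deriv[OF assms] op])
        (use u c in auto)
    then show ?thesis using DERIV_unique[OF _ DERIV_const] by blast
  qed
  then show ?case by blast
qed

text \<open>Gives meaning to the supremum in \<open>B_const\<close>, which is an upper bound only if
  the set is bounded above.\<close>

lemma smooth_cutoff_deriv_bounded:
  assumes "smooth_cutoff \<rho>"
  shows "bdd_above (range (\<lambda>u. \<bar>(deriv ^^ k) \<rho> u\<bar>))"
proof -
  obtain c where c: "\<And>u. 1 < \<bar>u\<bar> \<Longrightarrow> (deriv ^^ k) \<rho> u = c"
    using smooth_cutoff_deriv_outside[OF assms] by blast
  have "continuous_on {-1..1} ((deriv ^^ k) \<rho>)"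
    by (intro continuous_at_imp_continuous_on ballI DERIV_isCont[OF smooth_cutoff_has_deriv[OF assms]])
  then have "bounded ((deriv ^^ k) \<rho> ` {-1..1})"
    by (intro compact_imp_bounded compact_continuous_image) auto
  then obtain b where b: "\<And>u. u \<in> {-1..1} \<Longrightarrow> \<bar>(deriv ^^ k) \<rho> u\<bar> \<le> b"
    unfolding bounded_iff by fastforce
  have "\<bar>(deriv ^^ k) \<rho> u\<bar> \<le> max b \<bar>c\<bar>" for u
    using b[of u] c[of u]
    by (cases "1 < \<bar>u\<bar>") (auto simp: not_less abs_le_iff[of u] intro: max.coboundedI1)
  then show ?thesis by (intro bdd_aboveI[of _ "max b \<bar>c\<bar>"]) auto
qed

lemma B_const_ge_1: "1 \<le> B_const \<rho> p"
  by (simp add: B_const_def)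

lemma B_const_bound:
  assumes "smooth_cutoff \<rho>" shows "\<bar>(deriv ^^ (p - 1)) \<rho> u\<bar> \<le> B_const \<rho> p"
  unfolding B_const_def
  by (intro max.coboundedI2 cSUP_upper smooth_cutoff_deriv_bounded assms) simp

text \<open>Closed form of the \<open>k\<close>-th derivative of \<open>h_fun\<close>. The first
  derivative is already \<rho>(s / \<tau>), so order \<open>Suc j\<close> carries the
  \<open>j\<close>-th derivative of \<rho>; this shift is why \<open>B_const\<close> uses order
  \<open>p - 1\<close> for the Lipschitz constant of the derivative of order
  \<open>p - 1\<close>.\<close>

definition h_deriv :: "(real \<Rightarrow> real) \<Rightarrow> real \<Rightarrow> nat \<Rightarrow> real \<Rightarrow> real" where
  "h_deriv \<rho> \<tau> k s = (case k of 0 \<Rightarrow> h_fun \<rho> \<tau> s | Suc j \<Rightarrow> (deriv ^^ j) \<rho> (s / \<tau>) / \<tau> ^ j)"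

lemma h_deriv_0 [simp]: "h_deriv \<rho> \<tau> 0 = h_fun \<rho> \<tau>"
  by (simp add: h_deriv_def fun_eq_iff)

lemma h_fun_0 [simp]: "h_fun \<rho> \<tau> 0 = 0"
  by (simp add: h_fun_def zero_ereal_def[symmetric])

lemma h_fun_has_derivative:
  assumes "smooth_cutoff \<rho>" "0 < \<tau>"
  shows "(h_fun \<rho> \<tau> has_real_derivative \<rho> (s / \<tau>)) (at s)"
proof -
  \<comment> \<open>The margin 1 puts \<open>s / \<tau>\<close> in the interior of the compact
    interval, where the derivative within it is the full derivative.\<close>
  define b where "b = \<bar>s / \<tau>\<bar> + 1"
  have b: "- b \<le> 0" "0 \<le> b" "s / \<tau> \<in> {-b<..<b}"
    unfolding b_def greaterThanLessThan_iff by linarith+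
  have "continuous_on {-b..b} \<rho>"
    using DERIV_isCont[OF smooth_cutoff_has_deriv[OF assms(1), of 0]]
    by (intro continuous_at_imp_continuous_on ballI) simp
  then have "((\<lambda>u. LBINT y=0..u. \<rho> y) has_vector_derivative \<rho> (s / \<tau>)) (at (s / \<tau>) within {-b..b})"
    using interval_integral_FTC2[of "-b" 0 b \<rho> "s / \<tau>"]
    using b by (simp add: zero_ereal_def)
  then have "((\<lambda>u. LBINT y=0..ereal u. \<rho> y) has_real_derivative \<rho> (s / \<tau>)) (at (s / \<tau>))"
    using b(3) by (simp add: has_real_derivative_iff_has_vector_derivative at_within_Icc_at)
  then have "((\<lambda>s. \<tau> * (LBINT y=0..ereal (s / \<tau>). \<rho> y)) has_real_derivative
      \<tau> * (\<rho> (s / \<tau>) * (1 / \<tau>))) (at s)"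
    by (intro DERIV_cmult DERIV_chain2[where g = "\<lambda>s. s / \<tau>"] DERIV_cdivide DERIV_ident)
  then show ?thesis using assms(2) by (simp add: h_fun_def[abs_def])
qed

lemma h_deriv_has_derivative:
  assumes "smooth_cutoff \<rho>" "0 < \<tau>"
  shows "(h_deriv \<rho> \<tau> k has_real_derivative h_deriv \<rho> \<tau> (Suc k) s) (at s)"
proof (cases k)
  case 0
  then show ?thesis using h_fun_has_derivative[OF assms] by (simp add: h_deriv_def)
next
  case (Suc j)
  have "((\<lambda>s. (deriv ^^ j) \<rho> (s / \<tau>) / \<tau> ^ j) has_real_derivative
      (deriv ^^ Suc j) \<rho> (s / \<tau>) * (1 / \<tau>) / \<tau> ^ j) (at s)"
    by (intro DERIV_cdivide DERIV_chain2[where g = "\<lambda>s. s / \<tau>"] smooth_cutoff_has_deriv[OF assms(1)] DERIV_ident)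
  then show ?thesis using Suc by (simp add: h_deriv_def[abs_def])
qed

lemma lipschitz_of_deriv_bound:
  fixes f f' :: "real \<Rightarrow> real"
  assumes "\<And>s. (f has_real_derivative f' s) (at s)" "\<And>s. \<bar>f' s\<bar> \<le> B"
  shows "\<bar>f s - f t\<bar> \<le> B * \<bar>s - t\<bar>"
  using field_differentiable_bound[of UNIV f f' B s t] assms
  by (auto simp: has_field_derivative_at_within)

lemma h_fun_lipschitz:
  assumes "smooth_cutoff \<rho>" "0 < \<tau>"
  shows "\<bar>h_fun \<rho> \<tau> s - h_fun \<rho> \<tau> t\<bar> \<le> \<bar>s - t\<bar>"
  using lipschitz_of_deriv_bound[of "h_fun \<rho> \<tau>" "\<lambda>s. \<rho> (s / \<tau>)" 1 s t]
    h_fun_has_derivative[OF assms] smooth_cutoffD(1,2)[OF assms(1)] by simp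

lemma h_fun_abs_le:
  assumes "smooth_cutoff \<rho>" "0 < \<tau>" shows "\<bar>h_fun \<rho> \<tau> s\<bar> \<le> \<bar>s\<bar>"
  using h_fun_lipschitz[OF assms, of s 0] by simp

lemma h_deriv_lipschitz:
  assumes "smooth_cutoff \<rho>" "0 < \<tau>" "1 \<le> p"
  shows "\<bar>h_deriv \<rho> \<tau> (p - 1) s - h_deriv \<rho> \<tau> (p - 1) t\<bar> \<le> B_const \<rho> p / \<tau> ^ (p - 1) * \<bar>s - t\<bar>"
proof (rule lipschitz_of_deriv_bound[OF h_deriv_has_derivative[OF assms(1,2)]])
  fix s
  show "\<bar>h_deriv \<rho> \<tau> (Suc (p - 1)) s\<bar> \<le> B_const \<rho> p / \<tau> ^ (p - 1)"
    using B_const_bound[OF assms(1), of p] assms(2) by (simp add: h_deriv_def divide_right_mono)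
qed

text \<open>The function h(s) - s has slope \<rho> - 1 \<le> 0 and is constant from \<tau> on, so
  its minimum is h(\<tau>) - \<tau> \<ge> -\<tau>. Thus a link of the chain loses at most
  \<tau>.\<close>

lemma h_fun_ge:
  assumes "smooth_cutoff \<rho>" "0 < \<tau>"
  shows "s - \<tau> \<le> h_fun \<rho> \<tau> s"
proof -
  have le: "h_fun \<rho> \<tau> b - b \<le> h_fun \<rho> \<tau> a - a" if "a \<le> b" for a b
    using h_fun_lipschitz[OF assms, of b a] that by linarith
  have eq: "h_fun \<rho> \<tau> s - s = h_fun \<rho> \<tau> \<tau> - \<tau>" if "\<tau> \<le> s"
  proof -
    have "\<bar>(h_fun \<rho> \<tau> s - s) - (h_fun \<rho> \<tau> \<tau> - \<tau>)\<bar> \<le> 0 * \<bar>s - \<tau>\<bar>"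
      unfolding real_norm_def[symmetric]
    proof (rule field_differentiable_bound[of "{\<tau>..}" "\<lambda>s. h_fun \<rho> \<tau> s - s" "\<lambda>s. \<rho> (s / \<tau>) - 1"])
      fix z assume z: "z \<in> {\<tau>..}"
      show "((\<lambda>s. h_fun \<rho> \<tau> s - s) has_field_derivative \<rho> (z / \<tau>) - 1) (at z within {\<tau>..})"
        by (rule has_field_derivative_at_within)
          (intro DERIV_diff h_fun_has_derivative[OF assms] DERIV_ident)
      have "1 \<le> \<bar>z / \<tau>\<bar>" using z assms(2) by (auto simp: field_simps)
      then have "\<rho> (z / \<tau>) = 1" by (intro smooth_cutoffD(4)[OF assms(1)])
      then show "norm (\<rho> (z / \<tau>) - 1) \<le> 0" by simp
    qed (use that in auto)
    then show ?thesis by simp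
  qed
  have "0 \<le> h_fun \<rho> \<tau> \<tau>"
  proof (rule DERIV_nonneg_imp_nondecreasing[of 0 \<tau> "h_fun \<rho> \<tau>", simplified])
    show "0 \<le> \<tau>" using assms by simp
    show "\<And>x. 0 \<le> x \<Longrightarrow> x \<le> \<tau> \<Longrightarrow> \<exists>y. (h_fun \<rho> \<tau> has_real_derivative y) (at x) \<and> 0 \<le> y"
      using h_fun_has_derivative[OF assms] smooth_cutoffD(1)[OF assms(1)] by blast
  qed
  then show ?thesis using le[of s \<tau>] eq by (cases "\<tau> \<le> s") auto
qed

lemma smooth_cutoff_deriv_inside:
  assumes "smooth_cutoff \<rho>" "\<bar>u\<bar> < 1/2"
  shows "(deriv ^^ k) \<rho> u = 0"
  using assms(2)
proof (induction k arbitrary: u)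
  case 0
  then show ?case using smooth_cutoffD(3)[OF assms(1)] by simp
next
  case (Suc k)
  have op: "open {u :: real. \<bar>u\<bar> < 1/2}" by (intro open_Collect_less continuous_intros)
  have "((\<lambda>_. 0) has_real_derivative (deriv ^^ Suc k) \<rho> u) (at u)"
    by (rule has_field_derivative_transform_within_open[OF smooth_cutoff_has_deriv[OF assms(1)] op])
      (use Suc in auto)
  then show ?case using DERIV_unique[OF _ DERIV_const] by blast
qed

text \<open>This hides \<open>V (i + 1)\<close> at points orthogonal to \<open>V i\<close> from an
  oracle of any order.\<close>

lemma h_deriv_at_0:
  assumes "smooth_cutoff \<rho>" shows "h_deriv \<rho> \<tau> k 0 = 0"
  using smooth_cutoff_deriv_inside[OF assms, of 0] by (cases k) (simp_all add: h_deriv_def)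

section \<open>Geometry of \<open>\<real>\<^sup>d\<close>\<close>

lemma coord_sum: "coord (sum f A) i = (\<Sum>a\<in>A. coord (f a) i)"
  by (induction A rule: infinite_finite_induct) auto

definition unit_vec :: "nat \<Rightarrow> fseq" where
  "unit_vec i = Abs_fseq (\<lambda>j. if j = i then 1 else 0)"

lemma coord_unit_vec [simp]: "coord (unit_vec i) j = (if j = i then 1 else 0)"
  by (simp add: unit_vec_def coord_Abs_fseq)

lemma inner_unit_vec [simp]: "unit_vec i \<bullet> x = coord x i"
  by (simp add: inner_fseq_eq[of "{i}"])

lemma inner_unit_vec_right [simp]: "x \<bullet> unit_vec i = coord x i"
  by (metis inner_commute inner_unit_vec)

lemma norm_unit_vec [simp]: "norm (unit_vec i) = 1"
  by (simp add: norm_fseq_def)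

lemma subspace_Rd [simp]: "subspace (Rd d)"
  by (simp add: subspace_def Rd_def)

lemmas Rd_0 [simp] = subspace_0[OF subspace_Rd]
  and Rd_add = subspace_add[OF subspace_Rd]
  and Rd_diff = subspace_diff[OF subspace_Rd]
  and Rd_scaleR = subspace_scale[OF subspace_Rd]
  and Rd_sum = subspace_sum[OF subspace_Rd]

lemma unit_vec_in_Rd: "i < d \<Longrightarrow> unit_vec i \<in> Rd d"
  by (simp add: Rd_def)

text \<open>A homogeneous system with fewer equations than unknowns: \<open>r i\<close> is the
  \<open>i\<close>-th column of its matrix, and a linear dependence among the \<open>d\<close>
  columns, which lie in a span of \<open>k\<close> vectors, has the coordinates of the solution as
  coefficients.\<close>

lemma exists_unit_orthogonal:
  assumes "finite W" "card W < d"
  shows "\<exists>v\<in>Rd d. norm v = 1 \<and> (\<forall>w\<in>W. v \<bullet> w = 0)"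
proof -
  define k where "k = card W"
  obtain w where W: "W = w ` {..<k}"
    using ex_bij_betw_nat_finite[OF assms(1)]
    by (metis atLeast0LessThan bij_betw_imp_surj_on k_def)
  define r where "r i = (\<Sum>j<k. coord (w j) i *\<^sub>R unit_vec j)" for i
  have coord_r: "coord (r i) j = coord (w j) i" if "j < k" for i j
    using that by (simp add: r_def coord_sum if_distrib cong: if_cong)
  have nonzero: "\<exists>v\<in>Rd d. v \<noteq> 0 \<and> (\<forall>j<k. v \<bullet> w j = 0)"
  \<comment> \<open>Dependence is a property of the set of columns, so two equal columns have to be
    treated separately.\<close>
  proof (cases "inj_on r {..<d}")
    case False
    then obtain i j where ij: "i < d" "j < d" "i \<noteq> j" "r i = r j" by (auto simp: inj_on_def)
    have "unit_vec i - unit_vec j \<noteq> 0"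
    proof
      assume "unit_vec i - unit_vec j = 0"
      then have "coord (unit_vec i - unit_vec j) i = 0" by simp
      then show False using ij by simp
    qed
    moreover have "(unit_vec i - unit_vec j) \<bullet> w l = 0" if "l < k" for l
      using coord_r[OF that] ij(4) by (metis diff_self inner_diff_left inner_unit_vec)
    ultimately show ?thesis
      using ij(1,2) by (intro bexI[of _ "unit_vec i - unit_vec j"]) (auto intro!: Rd_diff unit_vec_in_Rd)
  next
    case True
    have "r ` {..<d} \<subseteq> span (unit_vec ` {..<k})"
      unfolding r_def by (intro image_subsetI span_sum span_scale span_base imageI)
    moreover have "card (unit_vec ` {..<k}) < card (r ` {..<d})"
      using card_image_le[of "{..<k}" unit_vec] True assms(2) by (simp add: card_image k_def)
    ultimately have "dependent (r ` {..<d})"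
      using independent_span_bound[of "unit_vec ` {..<k}" "r ` {..<d}"] by auto
    then obtain u where u: "\<exists>y\<in>r ` {..<d}. u y \<noteq> 0" "(\<Sum>y\<in>r ` {..<d}. u y *\<^sub>R y) = 0"
      using dependent_finite[of "r ` {..<d}"] by auto
    define v where "v = (\<Sum>i<d. u (r i) *\<^sub>R unit_vec i)"
    have sum0: "(\<Sum>i<d. u (r i) *\<^sub>R r i) = 0"
      using u(2) True by (simp add: sum.reindex)
    have "v \<bullet> w j = 0" if "j < k" for j
    proof -
      have "v \<bullet> w j = (\<Sum>i<d. u (r i) * coord (r i) j)"
        using that by (simp add: v_def inner_sum_left coord_r)
      also have "\<dots> = coord (\<Sum>i<d. u (r i) *\<^sub>R r i) j" by (simp add: coord_sum)
      finally show ?thesis by (simp add: sum0)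
    qed
    moreover have "v \<noteq> 0"
    proof
      assume "v = 0"
      obtain i where i: "i < d" "u (r i) \<noteq> 0" using u(1) by auto
      have "coord v i = u (r i)"
        using i(1) by (simp add: v_def coord_sum if_distrib cong: if_cong)
      then show False using \<open>v = 0\<close> i(2) by simp
    qed
    moreover have "v \<in> Rd d" by (auto simp: v_def intro!: Rd_sum Rd_scaleR unit_vec_in_Rd)
    ultimately show ?thesis by blast
  qed
  then obtain v where "v \<in> Rd d" "v \<noteq> 0" "\<forall>j<k. v \<bullet> w j = 0" by blast
  then show ?thesis
    by (intro bexI[of _ "v /\<^sub>R norm v"]) (auto simp: W Rd_scaleR)
qed

section \<open>Compactness, convexity and diameter of the ball\<close>

lemma closed_Rd: "closed (Rd d)"
proof -
  have "closed (\<Inter>i\<in>{d..}. {x. unit_vec i \<bullet> x = 0})"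
    by (intro closed_INT ballI closed_hyperplane)
  moreover have "Rd d = (\<Inter>i\<in>{d..}. {x. unit_vec i \<bullet> x = 0})" by (auto simp: Rd_def)
  ultimately show ?thesis by simp
qed

lemma Bd_iff: "x \<in> Bd d R \<longleftrightarrow> norm x \<le> R \<and> x \<in> Rd d"
  by (simp add: Bd_def)

text \<open>The ambient space is infinite-dimensional, so closed balls in it are not compact.
  Induction on the dimension: splitting off the last coordinate places the ball as a closed subset
  of a continuous image of a lower-dimensional ball times an interval.\<close>

lemma compact_Bd: "compact (Bd d R)"
proof (induction d)
  case 0
  have "Rd 0 = {0}" by (auto simp: Rd_def intro!: fseq_eqI)
  then have "Bd 0 R = (if 0 \<le> R then {0} else {})" by (auto simp: Bd_def)
  then show ?case by simp
next
  case (Suc d)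
  let ?f = "\<lambda>y. fst y + snd y *\<^sub>R unit_vec d"
  have "compact (?f ` (Bd d R \<times> {-R..R}))"
    by (intro compact_continuous_image compact_Times Suc compact_Icc continuous_intros)
  moreover have sub: "Bd (Suc d) R \<subseteq> ?f ` (Bd d R \<times> {-R..R})"
  proof
    fix x assume x: "x \<in> Bd (Suc d) R"
    define t where "t = coord x d"
    define y where "y = x - t *\<^sub>R unit_vec d"
    have "\<bar>t\<bar> \<le> norm x"
      using Cauchy_Schwarz_ineq2[of "unit_vec d" x] by (simp add: t_def)
    moreover have "y \<in> Rd d"
      unfolding Rd_def mem_Collect_eq
    proof (intro allI impI)
      fix i assume "d \<le> i"
      then show "coord y i = 0" using x by (cases "i = d") (auto simp: y_def t_def Bd_iff Rd_def)
    qed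
    moreover have "norm y \<le> norm x"
    proof -
      have "y \<bullet> y = x \<bullet> x - t * t"
        by (simp only: y_def t_def inner_diff_left inner_diff_right inner_scaleR_left
            inner_scaleR_right inner_unit_vec inner_unit_vec_right coord_diff coord_scaleR
            coord_unit_vec) simp
      then show ?thesis by (simp add: norm_le)
    qed
    moreover have "norm x \<le> R" using x by (simp add: Bd_iff)
    ultimately have "(y, t) \<in> Bd d R \<times> {-R..R}" 
      using Cauchy_Schwarz_ineq2[of "unit_vec d" x] by (auto simp: Bd_iff t_def)
    moreover have "x = ?f (y, t)" by (simp add: y_def)
    ultimately show "x \<in> ?f ` (Bd d R \<times> {-R..R})" by (rule rev_image_eqI)
  qed
  moreover have "closed (Bd (Suc d) R)" by (simp add: Bd_def closed_Int closed_Rd)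
  ultimately have "compact (?f ` (Bd d R \<times> {-R..R}) \<inter> Bd (Suc d) R)"
    by (intro compact_Int_closed)
  moreover have "?f ` (Bd d R \<times> {-R..R}) \<inter> Bd (Suc d) R = Bd (Suc d) R"
    using sub by blast
  ultimately show ?case by simp
qed

lemma convex_Bd: "convex (Bd d R)"
  by (simp add: Bd_def convex_Int subspace_imp_convex)

lemma diameter_Bd: "0 \<le> R \<Longrightarrow> diameter (Bd d R) \<le> 2 * R"
proof (rule diameter_le)
  fix x y assume "x \<in> Bd d R" "y \<in> Bd d R"
  then show "norm (x - y) \<le> 2 * R" using norm_triangle_ineq4[of x y] by (simp add: Bd_iff)
qed simp

text \<open>Restriction to the line through \<open>x\<close> in direction \<open>u\<close>, which
  stays in \<open>Rd d\<close>, reduces this to uniqueness in one variable.\<close>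

lemma has_derivative_within_Rd_unique:
  assumes "(f has_derivative f1) (at x within Rd d)" "(f has_derivative f2) (at x within Rd d)"
    and "x \<in> Rd d" "u \<in> Rd d"
  shows "f1 u = f2 u"
proof -
  have line: "((\<lambda>t. f (x + t *\<^sub>R u)) has_vector_derivative f' u) (at 0)"
    if "(f has_derivative f') (at x within Rd d)" for f'
  proof -
    have "(f has_derivative f') (at (x + 0 *\<^sub>R u) within range (\<lambda>t. x + t *\<^sub>R u))"
      using that by (auto intro: has_derivative_subset intro!: Rd_add Rd_scaleR assms)
    moreover have "((\<lambda>t. x + t *\<^sub>R u) has_derivative (\<lambda>t. t *\<^sub>R u)) (at 0)"
      by (auto intro!: derivative_eq_intros)
    ultimately have "((\<lambda>t. f (x + t *\<^sub>R u)) has_derivative (\<lambda>t. f' (t *\<^sub>R u))) (at 0)"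
      by (rule has_derivative_in_compose[rotated])
    then show ?thesis
      using linear_cmul[OF has_derivative_linear[OF that]] by (simp add: has_vector_derivative_def)
  qed
  show ?thesis using vector_derivative_unique_at[OF line[OF assms(1)] line[OF assms(2)]] .
qed

lemma frechet_derivative_within_Rd:
  assumes "(f has_derivative f') (at x within Rd d)" "x \<in> Rd d" "u \<in> Rd d"
  shows "frechet_derivative f (at x within Rd d) u = f' u"
  using has_derivative_within_Rd_unique[OF _ assms] frechet_derivative_works assms(1)
  by (blast intro: differentiableI)

subsection \<open>Orthonormal families\<close>

text \<open>The index set is free because three families occur: the whole frame, the sources v_1,
  ..., v_N of the links and their targets v_2, ..., v_(N+1).\<close>

locale orthonormal_family =
  fixes I :: "'i set" and V :: "'i \<Rightarrow> 'a :: real_inner"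
  assumes finite_index: "finite I"
    and inner_family: "\<And>i j. i \<in> I \<Longrightarrow> j \<in> I \<Longrightarrow> V i \<bullet> V j = (if i = j then 1 else 0)"
begin

lemma inner_combination: "j \<in> I \<Longrightarrow> V j \<bullet> (\<Sum>i\<in>I. a i *\<^sub>R V i) = a j"
  using finite_index by (simp add: inner_sum_right inner_family if_distrib cong: if_cong)

lemma norm_combination: "norm (\<Sum>i\<in>I. a i *\<^sub>R V i) ^ 2 = (\<Sum>i\<in>I. (a i)\<^sup>2)"
  unfolding power2_norm_eq_inner
  by (subst inner_sum_left) (simp add: inner_combination power2_eq_square)

lemma bessel: "(\<Sum>i\<in>I. (V i \<bullet> x)\<^sup>2) \<le> norm x ^ 2"
proof -
  define y where "y = (\<Sum>i\<in>I. (V i \<bullet> x) *\<^sub>R V i)"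
  have "y \<bullet> x = (\<Sum>i\<in>I. (V i \<bullet> x)\<^sup>2)"
    by (simp add: y_def inner_sum_left power2_eq_square)
  moreover have "y \<bullet> y = (\<Sum>i\<in>I. (V i \<bullet> x)\<^sup>2)"
    using norm_combination[of "\<lambda>i. V i \<bullet> x"] by (simp add: y_def power2_norm_eq_inner)
  moreover have "0 \<le> (x - y) \<bullet> (x - y)" by simp
  ultimately show ?thesis
    by (simp add: inner_diff_left inner_diff_right inner_commute[of x y] power2_norm_eq_inner)
qed

text \<open>Parseval for the family \<open>V\<close>, then Bessel for \<open>V'\<close>. The chain
  reads coordinates along the sources and writes along the targets, so two families are
  involved.\<close>

lemma norm_combination_le:
  assumes "\<And>i. i \<in> I \<Longrightarrow> \<bar>a i\<bar> \<le> b * \<bar>V' i \<bullet> x\<bar>" "orthonormal_family I V'" "0 \<le> b"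
  shows "norm (\<Sum>i\<in>I. a i *\<^sub>R V i) \<le> b * norm x"
proof (rule power2_le_imp_le)
  have "norm (\<Sum>i\<in>I. a i *\<^sub>R V i) ^ 2 = (\<Sum>i\<in>I. \<bar>a i\<bar>\<^sup>2)" by (simp add: norm_combination)
  also have "\<dots> \<le> (\<Sum>i\<in>I. (b * \<bar>V' i \<bullet> x\<bar>)\<^sup>2)"
    using assms(1) by (intro sum_mono power_mono) auto
  also have "\<dots> = b\<^sup>2 * (\<Sum>i\<in>I. (V' i \<bullet> x)\<^sup>2)"
    by (simp add: power_mult_distrib sum_distrib_left)
  also have "\<dots> \<le> b\<^sup>2 * norm x ^ 2"
    by (intro mult_left_mono orthonormal_family.bessel assms(2)) simp
  finally show "norm (\<Sum>i\<in>I. a i *\<^sub>R V i) ^ 2 \<le> (b * norm x)\<^sup>2" by (simp add: power_mult_distrib)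
qed (use assms(3) in simp)

end

lemma orthonormal_frame_family:
  assumes "orthonormal_frame d (N + 1) V"
  shows "orthonormal_family {1..N + 1} V" "orthonormal_family {1..N} V"
    "orthonormal_family {1..N} (\<lambda>i. V (i + 1))"
  using assms by (auto simp: orthonormal_frame_def orthonormal_family_def)

section \<open>Derivatives of the hard operators\<close>

lemma par_pos:
  assumes "0 < R"
  shows "0 < c_par R N" "0 < tau_par R N" "0 < q_par N" "q_par N \<le> 1"
proof -
  show c: "0 < c_par R N" using assms by (simp add: c_par_def)
  then show "0 < tau_par R N" by (simp add: tau_par_def)
  show "0 < q_par N" "q_par N \<le> 1" by (auto simp: q_par_def field_simps)
qed

lemma lam_par_pos: "0 < L \<Longrightarrow> 0 < R \<Longrightarrow> 0 < lam_par \<rho> p L R N"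
  using B_const_ge_1[of \<rho> p] by (simp add: lam_par_def par_pos)

definition affine_deriv :: "fseq \<Rightarrow> fseq list \<Rightarrow> fseq \<Rightarrow> fseq" where
  "affine_deriv a us x = (case us of [] \<Rightarrow> x - a | [u] \<Rightarrow> u | _ \<Rightarrow> 0)"

text \<open>Closed form of the derivatives of \<open>F_op\<close>: a link depends on
  \<open>x\<close> through one linear form only, so its \<open>k\<close>-th derivative is a scalar
  derivative times a product of that form's values.\<close>

definition F_deriv ::
  "(real \<Rightarrow> real) \<Rightarrow> nat \<Rightarrow> real \<Rightarrow> real \<Rightarrow> nat \<Rightarrow> (nat \<Rightarrow> fseq) \<Rightarrow> fseq list \<Rightarrow> fseq \<Rightarrow> fseq" where
  "F_deriv \<rho> p L R N V us x = lam_par \<rho> p L R N *\<^sub>R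
     (affine_deriv (c_par R N *\<^sub>R V 1) us x - q_par N *\<^sub>R
       (\<Sum>i = 1..N. (h_deriv \<rho> (tau_par R N) (length us) (V i \<bullet> x) * (\<Prod>u\<leftarrow>us. V i \<bullet> u))
          *\<^sub>R V (i + 1)))"

lemma F_deriv_Nil: "F_deriv \<rho> p L R N V [] = F_op \<rho> p L R N V"
  by (simp add: fun_eq_iff F_deriv_def F_op_def T_op_def affine_deriv_def algebra_simps)

lemma affine_deriv_has_derivative:
  "(affine_deriv a us has_derivative (\<lambda>u. affine_deriv a (u # us) x)) (at x within S)"
proof (cases us)
  case Nil
  then show ?thesis unfolding affine_deriv_def[abs_def]
    by (auto intro!: derivative_eq_intros)
next
  case (Cons v vs)
  then show ?thesis unfolding affine_deriv_def[abs_def] by (cases vs) auto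
qed

lemma F_deriv_has_derivative:
  assumes "smooth_cutoff \<rho>" "0 < R"
  shows "(F_deriv \<rho> p L R N V us has_derivative (\<lambda>u. F_deriv \<rho> p L R N V (u # us) x)) (at x within S)"
proof -
  let ?\<tau> = "tau_par R N"
  have h: "((\<lambda>x. h_deriv \<rho> ?\<tau> k (v \<bullet> x)) has_derivative
      (\<lambda>u. h_deriv \<rho> ?\<tau> (Suc k) (v \<bullet> x) * (v \<bullet> u))) (at x within S)" for k v
  proof -
    have "(h_deriv \<rho> ?\<tau> k has_derivative (*) (h_deriv \<rho> ?\<tau> (Suc k) (v \<bullet> x))) (at (v \<bullet> x))"
      using h_deriv_has_derivative[OF assms(1) par_pos(2)[OF assms(2)]]
      by (simp add: has_field_derivative_def)
    moreover have "((\<lambda>x. v \<bullet> x) has_derivative (\<lambda>u. v \<bullet> u)) (at x within S)"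
      by (intro has_derivative_inner_right has_derivative_ident)
    ultimately show ?thesis by (rule has_derivative_compose[rotated])
  qed
  have "((\<lambda>x. lam_par \<rho> p L R N *\<^sub>R
     (affine_deriv (c_par R N *\<^sub>R V 1) us x - q_par N *\<^sub>R
       (\<Sum>i = 1..N. (h_deriv \<rho> ?\<tau> (length us) (V i \<bullet> x) * (\<Prod>u\<leftarrow>us. V i \<bullet> u)) *\<^sub>R V (i + 1))))
    has_derivative (\<lambda>u. lam_par \<rho> p L R N *\<^sub>R
     (affine_deriv (c_par R N *\<^sub>R V 1) (u # us) x - q_par N *\<^sub>R
       (\<Sum>i = 1..N. ((h_deriv \<rho> ?\<tau> (Suc (length us)) (V i \<bullet> x) * (V i \<bullet> u)) *
          (\<Prod>u\<leftarrow>us. V i \<bullet> u)) *\<^sub>R V (i + 1))))) (at x within S)"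
    by (intro has_derivative_scaleR_right has_derivative_diff affine_deriv_has_derivative
        has_derivative_sum has_derivative_scaleR_left has_derivative_mult_left h)
  then show ?thesis by (simp add: F_deriv_def[abs_def] mult.assoc)
qed

text \<open>The induction must carry all \<open>x\<close> in \<open>Rd d\<close> at once, since
  differentiating within \<open>Rd d\<close> uses the equality around the point.\<close>

lemma nderiv_F_op:
  assumes "smooth_cutoff \<rho>" "0 < R"
  shows "set us \<subseteq> Rd d \<Longrightarrow> x \<in> Rd d \<Longrightarrow> nderiv d (F_op \<rho> p L R N V) us x = F_deriv \<rho> p L R N V us x"
proof (induction us arbitrary: x)
  case Nil
  then show ?case by (simp add: F_deriv_Nil)
next
  case (Cons u us)
  have "(nderiv d (F_op \<rho> p L R N V) us has_derivative (\<lambda>u. F_deriv \<rho> p L R N V (u # us) x))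
      (at x within Rd d)"
    by (rule has_derivative_transform[OF _ _ F_deriv_has_derivative[OF assms]])
      (use Cons in auto)
  then show ?case using Cons.prems by (simp add: frechet_derivative_within_Rd)
qed

section \<open>Range, multilinearity and dependence on the frame\<close>

lemma F_deriv_in_Rd:
  assumes "V \<in> {1..N + 1} \<rightarrow> Rd d" "set us \<subseteq> Rd d" "x \<in> Rd d"
  shows "F_deriv \<rho> p L R N V us x \<in> Rd d"
  using assms unfolding F_deriv_def
  by (intro Rd_scaleR Rd_diff Rd_sum)
    (auto simp: affine_deriv_def split: list.split intro!: Rd_diff Rd_scaleR)

lemma prod_list_update_linear:
  fixes g :: "'a \<Rightarrow> real"
  assumes "i < length us" "g w = a * g u + b * g v"
  shows "(\<Prod>u\<leftarrow>us[i := w]. g u) = a * (\<Prod>u\<leftarrow>us[i := u]. g u) + b * (\<Prod>u\<leftarrow>us[i := v]. g u)"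
  using assms
proof (induction us arbitrary: i)
  case (Cons y ys)
  then show ?case by (cases i) (simp_all add: algebra_simps)
qed simp

lemma affine_deriv_update_linear:
  assumes "i < length us"
  shows "affine_deriv c (us[i := a *\<^sub>R u + b *\<^sub>R v]) x =
    a *\<^sub>R affine_deriv c (us[i := u]) x + b *\<^sub>R affine_deriv c (us[i := v]) x"
  using assms
  by (cases us; cases "tl us"; cases i) (auto simp: affine_deriv_def split: list.split nat.split)

lemma F_deriv_update_linear:
  assumes "i < length us"
  shows "F_deriv \<rho> p L R N V (us[i := a *\<^sub>R u + b *\<^sub>R v]) x =
    a *\<^sub>R F_deriv \<rho> p L R N V (us[i := u]) x + b *\<^sub>R F_deriv \<rho> p L R N V (us[i := v]) x"
proof -
  have prod: "(\<Prod>u\<leftarrow>us[i := a *\<^sub>R u + b *\<^sub>R v]. V j \<bullet> u) =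
      a * (\<Prod>u\<leftarrow>us[i := u]. V j \<bullet> u) + b * (\<Prod>u\<leftarrow>us[i := v]. V j \<bullet> u)" for j
    by (rule prod_list_update_linear[OF assms]) (simp add: inner_add_right)
  show ?thesis
    unfolding F_deriv_def affine_deriv_update_linear[OF assms] prod length_list_update
    by (simp add: algebra_simps sum.distrib scaleR_sum_right)
qed

text \<open>Apart from v_1 in the shift, the frame enters only through the links. A link that is not
  shared by the two frames is silent in both, with all derivatives.\<close>

lemma F_deriv_cong:
  assumes "smooth_cutoff \<rho>" "V 1 = V' 1"
    and "\<And>i. i \<in> {1..N} \<Longrightarrow>
      V i = V' i \<and> V (i + 1) = V' (i + 1) \<or> V i \<bullet> x = 0 \<and> V' i \<bullet> x = 0"
  shows "F_deriv \<rho> p L R N V us x = F_deriv \<rho> p L R N V' us x"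
proof -
  have "(\<Sum>i = 1..N. (h_deriv \<rho> (tau_par R N) (length us) (V i \<bullet> x) * (\<Prod>u\<leftarrow>us. V i \<bullet> u)) *\<^sub>R V (i + 1))
      = (\<Sum>i = 1..N. (h_deriv \<rho> (tau_par R N) (length us) (V' i \<bullet> x) * (\<Prod>u\<leftarrow>us. V' i \<bullet> u)) *\<^sub>R V' (i + 1))"
    (is "sum ?f _ = sum ?g _")
  proof (rule sum.cong[OF refl])
    fix i assume "i \<in> {1..N}"
    from assms(3)[OF this] show "?f i = ?g i"
      by (auto simp: h_deriv_at_0[OF assms(1)])
  qed
  then show ?thesis using assms(2) by (simp add: F_deriv_def)
qed

lemma oracle_answer_cong:
  assumes "smooth_cutoff \<rho>" "0 < R" "x \<in> Rd d" "V 1 = V' 1"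
    and "\<And>i. i \<in> {1..N} \<Longrightarrow>
      V i = V' i \<and> V (i + 1) = V' (i + 1) \<or> V i \<bullet> x = 0 \<and> V' i \<bullet> x = 0"
  shows "oracle_answer d p (F_op \<rho> p L R N V) x = oracle_answer d p (F_op \<rho> p L R N V') x"
proof -
  have "F_deriv \<rho> p L R N V us x = F_deriv \<rho> p L R N V' us x" for us
    by (rule F_deriv_cong[OF assms(1,4,5)])
  then show ?thesis
    unfolding oracle_answer_def
    by (intro restrict_ext) (simp add: tuples_def nderiv_F_op[OF assms(1,2) _ assms(3)])
qed

text \<open>Measurability constrains an algorithm only on genuine transcripts, so the answers must
  be shown to be such. Orthonormality is not assumed, because partial frames padded by zeros are
  used too.\<close>

lemma oracle_answer_in_space:
  assumes "smooth_cutoff \<rho>" "0 < R" "V \<in> {1..N + 1} \<rightarrow> Rd d" "x \<in> Rd d"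
  shows "oracle_answer d p (F_op \<rho> p L R N V) x \<in> space (answer_space d p)"
proof -
  have "(\<lambda>us\<in>tuples d k. nderiv d (F_op \<rho> p L R N V) us x) \<in> space (mlin_space d k)" for k
  proof -
    let ?M = "\<lambda>us\<in>tuples d k. nderiv d (F_op \<rho> p L R N V) us x"
    have eq: "?M us = F_deriv \<rho> p L R N V us x" if "us \<in> tuples d k" for us
      using that assms by (simp add: tuples_def nderiv_F_op)
    have upd: "us[i := w] \<in> tuples d k" if "us \<in> tuples d k" "w \<in> Rd d" for us i w
      using that set_update_subset_insert[of us i w] by (auto simp: tuples_def)
    have "?M us \<in> Rd d" if "us \<in> tuples d k" for us
      using that unfolding eq[OF that] by (intro F_deriv_in_Rd assms) (simp_all add: tuples_def)
    then have "?M \<in> tuples d k \<rightarrow>\<^sub>E Rd d" by (intro restrict_PiE_iff[THEN iffD2]) simp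
    moreover have "?M (us[i := a *\<^sub>R u + b *\<^sub>R v]) = a *\<^sub>R ?M (us[i := u]) + b *\<^sub>R ?M (us[i := v])"
      if "us \<in> tuples d k" "i < k" "u \<in> Rd d" "v \<in> Rd d" for us i u v a b
    proof -
      have "a *\<^sub>R u + b *\<^sub>R v \<in> Rd d" using that by (intro Rd_add Rd_scaleR)
      then show ?thesis
        using that eq upd F_deriv_update_linear[of i us] by (simp add: tuples_def)
    qed
    ultimately have "?M \<in> mlin_maps d k" unfolding mlin_maps_def by blast
    then show ?thesis
      by (auto simp: mlin_space_def space_restrict_space space_PiM mlin_maps_def)
  qed
  then show ?thesis by (simp add: oracle_answer_def answer_space_def space_PiM)
qed

section \<open>Membership in the operator class\<close>

context
  fixes \<rho> :: "real \<Rightarrow> real" and p N d :: nat and L R :: real and V :: "nat \<Rightarrow> fseq"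
  assumes cutoff: "smooth_cutoff \<rho>" and LR: "0 < L" "0 < R" and p: "2 \<le> p"
    and frame: "orthonormal_frame d (N + 1) V"
begin

interpretation target: orthonormal_family "{1..N}" "\<lambda>i. V (i + 1)"
  by (rule orthonormal_frame_family(3)[OF frame])

lemma frame_in_Rd: "V \<in> {1..N + 1} \<rightarrow> Rd d"
  using frame by (auto simp: orthonormal_frame_def)

text \<open>The nonlinear part of \<open>T_op\<close> is q-Lipschitz with q \<le> 1, so by
  Cauchy-Schwarz it cannot outweigh the identity.\<close>

lemma F_op_monotone: "monotone_operator_on X (F_op \<rho> p L R N V)"
  unfolding monotone_operator_on_def
proof (intro ballI)
  fix x y
  let ?h = "h_fun \<rho> (tau_par R N)"
  define S where "S = (\<Sum>i = 1..N. (?h (V i \<bullet> x) - ?h (V i \<bullet> y)) *\<^sub>R V (i + 1))"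
  have F: "F_op \<rho> p L R N V x - F_op \<rho> p L R N V y = lam_par \<rho> p L R N *\<^sub>R ((x - y) - q_par N *\<^sub>R S)"
    by (simp add: F_op_def T_op_def S_def algebra_simps sum_subtractf)
  have "norm S \<le> 1 * norm (x - y)"
    unfolding S_def
  proof (rule target.norm_combination_le[OF _ orthonormal_frame_family(2)[OF frame]])
    fix i
    show "\<bar>?h (V i \<bullet> x) - ?h (V i \<bullet> y)\<bar> \<le> 1 * \<bar>V i \<bullet> (x - y)\<bar>"
      using h_fun_lipschitz[OF cutoff par_pos(2)[OF LR(2)]] by (simp add: inner_diff_right)
  qed simp
  then have "norm S * norm (x - y) \<le> norm (x - y) * norm (x - y)"
    by (intro mult_right_mono) simp_all
  then have "\<bar>S \<bullet> (x - y)\<bar> \<le> norm (x - y) * norm (x - y)"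
    using Cauchy_Schwarz_ineq2[of S "x - y"] by linarith
  then have "q_par N * \<bar>S \<bullet> (x - y)\<bar> \<le> 1 * (norm (x - y) * norm (x - y))"
    using par_pos(4)[OF LR(2), of N] by (intro mult_mono) simp_all
  moreover have "q_par N * (S \<bullet> (x - y)) \<le> q_par N * \<bar>S \<bullet> (x - y)\<bar>"
    using par_pos(3)[OF LR(2), of N] by (intro mult_left_mono) simp_all
  ultimately have "q_par N * (S \<bullet> (x - y)) \<le> norm (x - y) * norm (x - y)" by linarith
  then have "0 \<le> ((x - y) - q_par N *\<^sub>R S) \<bullet> (x - y)"
    by (simp add: inner_diff_left[of "x - y"] dot_square_norm power2_eq_square)
  then show "0 \<le> (F_op \<rho> p L R N V x - F_op \<rho> p L R N V y) \<bullet> (x - y)"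
    unfolding F inner_scaleR_left
    using lam_par_pos[OF LR] by (intro mult_nonneg_nonneg) (auto intro: less_imp_le)
qed

text \<open>This estimate dictates \<open>lam_par\<close>: the factor B / \<tau>^(p-1) of the scalar
  derivative cancels exactly to \<open>L\<close>.\<close>

lemma F_deriv_lipschitz:
  assumes "length us = p - 1" "\<forall>u\<in>set us. norm u \<le> 1"
  shows "norm (F_deriv \<rho> p L R N V us x - F_deriv \<rho> p L R N V us y) \<le> L * norm (x - y)"
proof -
  let ?h = "h_deriv \<rho> (tau_par R N) (p - 1)"
  let ?B = "B_const \<rho> p / tau_par R N ^ (p - 1)"
  let ?P = "\<lambda>i. \<Prod>u\<leftarrow>us. V i \<bullet> u"
  define S where "S = (\<Sum>i = 1..N. ((?h (V i \<bullet> x) - ?h (V i \<bullet> y)) * ?P i) *\<^sub>R V (i + 1))"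
  \<comment> \<open>As \<open>p \<ge> 2\<close>, at least one differentiation has taken place, and
    the affine part no longer depends on the point.\<close>
  have "affine_deriv a us x = affine_deriv a us y" for a
    using assms(1) p by (cases us) (auto simp: affine_deriv_def split: list.split)
  then have F: "F_deriv \<rho> p L R N V us x - F_deriv \<rho> p L R N V us y =
      - ((lam_par \<rho> p L R N * q_par N) *\<^sub>R S)"
    by (simp add: F_deriv_def S_def assms(1) algebra_simps sum_subtractf)
  have B: "0 \<le> ?B" using B_const_ge_1[of \<rho> p] par_pos(2)[OF LR(2), of N]
    by (intro divide_nonneg_nonneg zero_le_power) linarith+
  have "norm S \<le> ?B * norm (x - y)"
    unfolding S_def
  proof (rule target.norm_combination_le[OF _ orthonormal_frame_family(2)[OF frame] B])
    fix i assume i: "i \<in> {1..N}"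
    then have norm_V: "norm (V i) = 1"
      using frame by (simp add: orthonormal_frame_def norm_eq_1)
    have "\<bar>V i \<bullet> u\<bar> \<le> 1" if "u \<in> set us" for u
      using Cauchy_Schwarz_ineq2[of "V i" u] assms(2) that norm_V by fastforce
    then have P: "\<bar>?P i\<bar> \<le> 1"
    proof (induction us)
      case (Cons u us)
      then show ?case using mult_mono[of "\<bar>V i \<bullet> u\<bar>" 1 "\<bar>\<Prod>u\<leftarrow>us. V i \<bullet> u\<bar>" 1]
        by (simp add: abs_mult)
    qed simp
    have "\<bar>?h (V i \<bullet> x) - ?h (V i \<bullet> y)\<bar> \<le> ?B * \<bar>V i \<bullet> (x - y)\<bar>"
      using h_deriv_lipschitz[OF cutoff par_pos(2)[OF LR(2)], of p] p by (simp add: inner_diff_right)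
    then show "\<bar>(?h (V i \<bullet> x) - ?h (V i \<bullet> y)) * ?P i\<bar> \<le> ?B * \<bar>V i \<bullet> (x - y)\<bar>"
      using mult_mono[OF _ P] B by (fastforce simp: abs_mult)
  qed
  then have "norm (F_deriv \<rho> p L R N V us x - F_deriv \<rho> p L R N V us y)
      \<le> lam_par \<rho> p L R N * q_par N * (?B * norm (x - y))"
    unfolding F norm_minus_cancel norm_scaleR
    using lam_par_pos[OF LR, of \<rho> p N] par_pos(3)[OF LR(2), of N] by (intro mult_mono) simp_all
  also have "lam_par \<rho> p L R N * q_par N * (?B * norm (x - y)) = q_par N * (L * norm (x - y))"
    using B_const_ge_1[of \<rho> p] par_pos(2)[OF LR(2), of N] by (simp add: lam_par_def)
  also have "\<dots> \<le> L * norm (x - y)"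
    using par_pos(4)[OF LR(2)] LR(1) by (intro mult_left_le_one_le) (auto simp: par_pos(3)[OF LR(2)] less_imp_le)
  finally show ?thesis .
qed

lemma F_op_in_op_class:
  assumes "X \<subseteq> Rd d"
  shows "F_op \<rho> p L R N V \<in> op_class d p L X"
  unfolding op_class_def mem_Collect_eq
proof (intro conjI exI[of _ "Rd d"] ballI F_op_monotone)
  show "F_op \<rho> p L R N V \<in> Rd d \<rightarrow> Rd d"
    using F_deriv_in_Rd[OF frame_in_Rd, of "[]"] by (auto simp: F_deriv_Nil)
  have D: "(nderiv d (F_op \<rho> p L R N V) us has_derivative (\<lambda>u. F_deriv \<rho> p L R N V (u # us) x))
      (at x within Rd d)" if "us \<in> tuples d j" "x \<in> Rd d" for us j x
    by (rule has_derivative_transform[OF _ _ F_deriv_has_derivative[OF cutoff LR(2)]])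
      (use that nderiv_F_op[OF cutoff LR(2)] in \<open>auto simp: tuples_def\<close>)
  show "Ck_on d (p - 1) (Rd d) (F_op \<rho> p L R N V)"
    unfolding Ck_on_def continuous_on_eq_continuous_within
    using D by (blast intro: differentiableI has_derivative_continuous)
  fix x y assume xy: "x \<in> X" "y \<in> X"
  show "mlin_opnorm d (p - 1)
      (\<lambda>us. nderiv d (F_op \<rho> p L R N V) us x - nderiv d (F_op \<rho> p L R N V) us y) \<le> L * norm (x - y)"
    unfolding mlin_opnorm_def
  proof (rule cSUP_least)
    have "replicate (p - 1) 0 \<in> {us \<in> tuples d (p - 1). \<forall>u\<in>set us. norm u \<le> 1}"
      by (auto simp: tuples_def)
    then show "{us \<in> tuples d (p - 1). \<forall>u\<in>set us. norm u \<le> 1} \<noteq> {}" by blast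
  next
    fix us assume "us \<in> {us \<in> tuples d (p - 1). \<forall>u\<in>set us. norm u \<le> 1}"
    then show "norm (nderiv d (F_op \<rho> p L R N V) us x - nderiv d (F_op \<rho> p L R N V) us y)
        \<le> L * norm (x - y)"
      using F_deriv_lipschitz[of us x y] xy[THEN subsetD[OF assms]]
      by (simp add: tuples_def nderiv_F_op[OF cutoff LR(2)])
  qed
qed (use assms in auto)

end

section \<open>The residual bound\<close>

lemma zero_in_normal_cone: "0 \<in> normal_cone d X x"
  by (simp add: normal_cone_def)

lemma r_tan_geI:
  assumes "\<And>n. n \<in> normal_cone d X x \<Longrightarrow> b \<le> norm (F x + n)"
  shows "b \<le> r_tan d X F x"
proof -
  have "(\<lambda>n. F x + n) ` normal_cone d X x \<noteq> {}" using zero_in_normal_cone by blast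
  then show ?thesis unfolding r_tan_def infdist_def
    by (simp add: image_image) (intro cINF_greatest; use zero_in_normal_cone assms in blast)
qed

lemma normal_cone_Bd_interior:
  assumes "norm x < R" "x \<in> Rd d" "n \<in> normal_cone d (Bd d R) x"
  shows "n = 0"
proof (rule ccontr)
  assume "n \<noteq> 0"
  \<comment> \<open>The longest step along \<open>n\<close> that the triangle inequality keeps
    inside the ball.\<close>
  define t where "t = (R - norm x) / norm n"
  have t: "0 < t" "t * norm n = R - norm x" using \<open>n \<noteq> 0\<close> assms(1) by (simp_all add: t_def)
  have n: "n \<in> Rd d" "\<And>z. z \<in> Bd d R \<Longrightarrow> n \<bullet> (z - x) \<le> 0"
    using assms(3) by (auto simp: normal_cone_def)
  have "norm (x + t *\<^sub>R n) \<le> norm x + t * norm n"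
    using norm_triangle_ineq[of x "t *\<^sub>R n"] t(1) by simp
  then have "x + t *\<^sub>R n \<in> Bd d R"
    using t(2) n(1) assms(2) by (simp add: Bd_iff Rd_add Rd_scaleR)
  from n(2)[OF this] have "t * (n \<bullet> n) \<le> 0" by simp
  moreover have "0 < t * (n \<bullet> n)" using t(1) \<open>n \<noteq> 0\<close> by simp
  ultimately show False by linarith
qed

text \<open>Tested at the centre of the ball. On the sphere this replaces the description of the
  cone as an outward ray.\<close>

lemma normal_cone_Bd_inner:
  assumes "0 \<le> R" "n \<in> normal_cone d (Bd d R) x"
  shows "0 \<le> n \<bullet> x"
proof -
  have "0 \<in> Bd d R" using assms(1) by (simp add: Bd_iff)
  then have "n \<bullet> (0 - x) \<le> 0" using assms(2) unfolding normal_cone_def by blast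
  then show ?thesis by simp
qed

text \<open>By Bernoulli, (1 - 1/(2m))^N \<ge> 1 - N/(2m): damping along the whole chain costs at
  most a factor 2.\<close>

lemma q_par_power_ge: "1 / 2 \<le> q_par N ^ N"
proof -
  have "1 + real N * (- (1 / (2 * real (N + 1)))) \<le> (1 + (- (1 / (2 * real (N + 1))))) ^ N"
    by (rule Bernoulli_inequality) (simp add: field_simps)
  also have "(1 + (- (1 / (2 * real (N + 1))))) ^ N = q_par N ^ N" by (simp add: q_par_def)
  finally have "1 + real N * (- (1 / (2 * real (N + 1)))) \<le> q_par N ^ N" .
  moreover have "1 / 2 \<le> 1 + real N * (- (1 / (2 * real (N + 1))))" by (simp add: field_simps)
  ultimately show ?thesis by linarith
qed

context
  fixes \<rho> :: "real \<Rightarrow> real" and N d :: nat and R :: real and V :: "nat \<Rightarrow> fseq"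
  assumes cutoff: "smooth_cutoff \<rho>" and R: "0 < R"
    and frame: "orthonormal_frame d (N + 1) V"
begin

interpretation full: orthonormal_family "{1..N + 1}" V
  by (rule orthonormal_frame_family(1)[OF frame])

interpretation target: orthonormal_family "{1..N}" "\<lambda>i. V (i + 1)"
  by (rule orthonormal_frame_family(3)[OF frame])

lemma inner_T_op_first: "V 1 \<bullet> T_op \<rho> R N V x = c_par R N"
  by (simp add: T_op_def inner_add_right inner_sum_right full.inner_family)

lemma inner_T_op_Suc:
  assumes "j \<in> {1..N}"
  shows "V (j + 1) \<bullet> T_op \<rho> R N V x = q_par N * h_fun \<rho> (tau_par R N) (V j \<bullet> x)"
  using assms target.inner_combination[OF assms]
  by (simp add: T_op_def inner_add_right full.inner_family)

text \<open>The coordinates of a near-fixed point of \<open>T\<close> decay slowly, so the last one cannot vanish.\<close>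

lemma coordinate_ge:
  assumes "j \<le> N"
  shows "q_par N ^ j * c_par R N - (\<Sum>i = 1..j + 1. \<bar>V i \<bullet> (x - T_op \<rho> R N V x)\<bar>)
    - real j * tau_par R N \<le> V (j + 1) \<bullet> x"
  using assms
proof (induction j)
  case 0
  have "V 1 \<bullet> x = V 1 \<bullet> (x - T_op \<rho> R N V x) + c_par R N"
    unfolding inner_diff_right inner_T_op_first by simp
  then show ?case by simp
next
  case (Suc j)
  let ?q = "q_par N" and ?\<tau> = "tau_par R N" and ?c = "c_par R N"
  define e where "e i = V i \<bullet> (x - T_op \<rho> R N V x)" for i
  define A where "A = (\<Sum>i = 1..j + 1. \<bar>e i\<bar>)"
  have IH: "?q ^ j * ?c - A - real j * ?\<tau> \<le> V (j + 1) \<bullet> x"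
    using Suc unfolding A_def e_def by simp
  have A: "0 \<le> A" by (simp add: A_def sum_nonneg)
  have q: "0 \<le> ?q" "?q \<le> 1" using par_pos[OF R, of N] by auto
  have \<tau>: "0 < ?\<tau>" using par_pos[OF R, of N] by auto
  have "V (Suc j + 1) \<bullet> x = e (Suc j + 1) + ?q * h_fun \<rho> ?\<tau> (V (j + 1) \<bullet> x)"
    using inner_T_op_Suc[of "j + 1"] Suc.prems by (simp add: e_def inner_diff_right)
  moreover have "?q * (?q ^ j * ?c - A - real j * ?\<tau> - ?\<tau>) \<le> ?q * h_fun \<rho> ?\<tau> (V (j + 1) \<bullet> x)"
    using IH h_fun_ge[OF cutoff \<tau>, of "V (j + 1) \<bullet> x"] q by (intro mult_left_mono) auto
  \<comment> \<open>Earlier errors are not amplified by a further link.\<close>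
  moreover have "?q * (A + (real j + 1) * ?\<tau>) \<le> A + (real j + 1) * ?\<tau>"
    using q A \<tau> by (intro mult_left_le_one_le) auto
  moreover have "(\<Sum>i = 1..Suc j + 1. \<bar>e i\<bar>) = A + \<bar>e (Suc j + 1)\<bar>" by (simp add: A_def)
  ultimately have "?q ^ Suc j * ?c - (\<Sum>i = 1..Suc j + 1. \<bar>e i\<bar>) - real (Suc j) * ?\<tau> \<le> V (Suc j + 1) \<bullet> x"
    by (simp add: algebra_simps)
  then show ?case by (simp add: e_def)
qed

text \<open>With a vanishing last coordinate, the errors along the frame sum to at least c/2 - c/8 =
  3c/8. Cauchy-Schwarz over m coordinates costs sqrt m, which leaves 3R/(16m), more than
  R/(8m).\<close>

lemma displacement_ge:
  assumes "V (N + 1) \<bullet> x = 0"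
  shows "R / (8 * real (N + 1)) \<le> norm (x - T_op \<rho> R N V x)"
proof -
  define y where "y = x - T_op \<rho> R N V x"
  define m where "m = real (N + 1)"
  have m: "0 < m" "real N \<le> m" by (simp_all add: m_def)
  define A where "A = (\<Sum>i = 1..N + 1. \<bar>V i \<bullet> y\<bar>)"
  let ?c = "c_par R N"
  have c: "0 < ?c" using par_pos[OF R] by auto
  have "real N * tau_par R N \<le> ?c / 8"
    using m c by (simp add: tau_par_def m_def[symmetric] field_simps)
  moreover have "1 / 2 * ?c \<le> q_par N ^ N * ?c"
    using q_par_power_ge c by (intro mult_right_mono) auto
  ultimately have A: "3 / 8 * ?c \<le> A"
    using coordinate_ge[of N x] assms unfolding A_def y_def by simp
  have "A\<^sup>2 \<le> (\<Sum>i = 1..N + 1. \<bar>V i \<bullet> y\<bar>\<^sup>2) * real (card {1..N + 1})"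
    unfolding A_def by (rule sum_squared_le_sum_of_squares)
  also have "\<dots> \<le> norm y ^ 2 * m"
    using full.bessel[of y] by (intro mult_mono) (auto simp: m_def)
  also have "\<dots> = (norm y * sqrt m)\<^sup>2" using m by (simp add: power_mult_distrib)
  finally have "A \<le> norm y * sqrt m" by (rule power2_le_imp_le) (use m in simp)
  with A have "3 / 8 * (R / (2 * sqrt m)) \<le> norm y * sqrt m"
    by (simp add: c_par_def m_def)
  then have "3 / 8 * (R / (2 * sqrt m)) * sqrt m \<le> norm y * sqrt m * sqrt m"
    using m by (intro mult_right_mono) auto
  moreover have "3 / 8 * (R / (2 * sqrt m)) * sqrt m = 3 / 16 * R" using m by simp
  moreover have "norm y * sqrt m * sqrt m = norm y * m" using m by simp
  ultimately have "R \<le> norm y * (8 * m)" using R by linarith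
  then show ?thesis unfolding y_def[symmetric] m_def[symmetric] using m by (simp add: field_simps)
qed

text \<open>The shift along v_1 is orthogonal to all targets, so Pythagoras gives c^2 + q^2 R^2
  instead of a sum of norms.\<close>

lemma norm_T_op_le:
  assumes "norm x \<le> R"
  shows "norm (T_op \<rho> R N V x) \<le> R * (1 - 1 / (8 * real (N + 1)))"
proof -
  define m where "m = real (N + 1)"
  have m: "1 \<le> m" by (simp add: m_def)
  define S where "S = (\<Sum>i = 1..N. h_fun \<rho> (tau_par R N) (V i \<bullet> x) *\<^sub>R V (i + 1))"
  have "norm S \<le> 1 * norm x" unfolding S_def
    by (rule target.norm_combination_le[OF _ orthonormal_frame_family(2)[OF frame]])
      (simp_all add: h_fun_abs_le[OF cutoff par_pos(2)[OF R]])
  then have S: "norm S \<le> R" using assms by simp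
  have V1S: "V 1 \<bullet> S = 0" by (simp add: S_def inner_sum_right full.inner_family)
  then have SV1: "S \<bullet> V 1 = 0" by (simp only: inner_commute)
  have V1: "V 1 \<bullet> V 1 = 1" by (simp add: full.inner_family)
  have "norm (T_op \<rho> R N V x) ^ 2 = c_par R N ^ 2 + q_par N ^ 2 * norm S ^ 2"
    unfolding power2_norm_eq_inner T_op_def S_def[symmetric]
    by (simp only: inner_add_left inner_add_right inner_scaleR_left inner_scaleR_right V1S SV1 V1)
      (simp add: power2_eq_square dot_square_norm)
  also have "\<dots> \<le> c_par R N ^ 2 + q_par N ^ 2 * R ^ 2"
    using S by (intro add_left_mono mult_left_mono power_mono) auto
  also have "\<dots> = R ^ 2 * (1 / (4 * m) + (1 - 1 / (2 * m)) ^ 2)"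
    unfolding c_par_def q_par_def m_def[symmetric]
    using m by (simp add: power_divide power_mult_distrib algebra_simps)
  also have "\<dots> \<le> R ^ 2 * (1 - 1 / (8 * m)) ^ 2"
  proof (intro mult_left_mono)
    \<comment> \<open>In terms of u the claim is 15 u^2 / 64 \<le> u / 2, which follows from u^2
      \<le> u.\<close>
    define u where "u = 1 / m"
    have u: "0 \<le> u" "u \<le> 1" using m by (simp_all add: u_def)
    have "u * u \<le> u" using u by (intro mult_left_le) auto
    then have "u / 4 + (1 - u / 2) ^ 2 \<le> (1 - u / 8) ^ 2"
      using u by (simp add: power2_eq_square algebra_simps)
    then show "1 / (4 * m) + (1 - 1 / (2 * m)) ^ 2 \<le> (1 - 1 / (8 * m)) ^ 2"
      by (simp add: u_def mult.commute)
  qed simp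
  also have "\<dots> = (R * (1 - 1 / (8 * m))) ^ 2" by (simp add: power_mult_distrib)
  finally show ?thesis unfolding m_def[symmetric]
    by (rule power2_le_imp_le) (use R m in simp)
qed

lemma r_tan_ge:
  assumes "0 < L" "x \<in> Bd d R" "V (N + 1) \<bullet> x = 0"
  shows "lam_par \<rho> p L R N * R / (8 * real (N + 1)) \<le> r_tan d (Bd d R) (F_op \<rho> p L R N V) x"
proof (rule r_tan_geI)
  fix n assume n: "n \<in> normal_cone d (Bd d R) x"
  let ?l = "lam_par \<rho> p L R N"
  have lam: "0 < ?l" using lam_par_pos[OF assms(1) R] .
  define y where "y = x - T_op \<rho> R N V x"
  have F: "F_op \<rho> p L R N V x = ?l *\<^sub>R y" by (simp add: F_op_def y_def)
  have x: "norm x \<le> R" "x \<in> Rd d" using assms(2) by (simp_all add: Bd_iff)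
  show "?l * R / (8 * real (N + 1)) \<le> norm (F_op \<rho> p L R N V x + n)"
  proof (cases "norm x < R")
    case True
    then have "n = 0" using normal_cone_Bd_interior x(2) n by blast
    moreover have "?l * (R / (8 * real (N + 1))) \<le> ?l * norm y"
      using displacement_ge[OF assms(3)] lam unfolding y_def by (intro mult_left_mono) simp_all
    ultimately show ?thesis using lam by (simp add: F)
  next
    case False
    then have xR: "norm x = R" using x(1) by simp
    \<comment> \<open>The gap between R and the norm of \<open>T_op\<close> on the ball, equal to
      the displacement bound used in the interior.\<close>
    define w where "w = R / (8 * real (N + 1))"
    have "T_op \<rho> R N V x \<bullet> x \<le> norm (T_op \<rho> R N V x) * R"
      using norm_cauchy_schwarz[of "T_op \<rho> R N V x" x] xR by simp
    also have "\<dots> \<le> (R - w) * R"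
      using norm_T_op_le[OF x(1)] R by (intro mult_right_mono) (simp_all add: w_def algebra_simps)
    finally have "w * R \<le> y \<bullet> x"
      using xR by (simp add: y_def inner_diff_left dot_square_norm power2_eq_square algebra_simps)
    then have "?l * (w * R) \<le> ?l * (y \<bullet> x)" using lam by (intro mult_left_mono) simp_all
    also have "\<dots> \<le> (F_op \<rho> p L R N V x + n) \<bullet> x"
      using normal_cone_Bd_inner[OF less_imp_le[OF R] n] by (simp add: F inner_add_left)
    also have "\<dots> \<le> norm (F_op \<rho> p L R N V x + n) * R"
      using norm_cauchy_schwarz[of "F_op \<rho> p L R N V x + n" x] xR by simp
    finally have "(?l * w) * R \<le> norm (F_op \<rho> p L R N V x + n) * R" by (simp add: mult.assoc)
    then have "?l * w \<le> norm (F_op \<rho> p L R N V x + n)" using R by simp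
    then show ?thesis by (simp add: w_def)
  qed
qed

end

section \<open>The resisting oracle\<close>

text \<open>Feasibility of a query is known only for histories in the transcript space, so both are
  established together along the run.\<close>

lemma run_in_space:
  assumes "smooth_cutoff \<rho>" "0 < R" "V \<in> {1..N + 1} \<rightarrow> Rd d"
    and alg: "det_algorithm d p (Bd d R) n Q out"
  shows "j \<le> n \<Longrightarrow> run d p (F_op \<rho> p L R N V) Q j \<in> space (transcript_space d p (Bd d R) j)"
proof (induction j)
  case 0
  then show ?case by (simp add: transcript_space_def space_PiM)
next
  case (Suc j)
  let ?F = "F_op \<rho> p L R N V"
  define h where "h = run d p ?F Q j"
  define x where "x = Q j h"
  have h: "h \<in> space (transcript_space d p (Bd d R) j)" using Suc by (simp add: h_def)
  have "Q j \<in> transcript_space d p (Bd d R) j \<rightarrow>\<^sub>M restrict_space borel (Bd d R)"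
    using alg Suc.prems by (simp add: det_algorithm_def)
  from measurable_space[OF this h] have x: "x \<in> Bd d R"
    by (simp add: x_def space_restrict_space)
  then have "(x, oracle_answer d p ?F x) \<in> Bd d R \<times> space (answer_space d p)"
    using oracle_answer_in_space[OF assms(1-3)] by (simp add: Bd_iff)
  then have "h(j := (x, oracle_answer d p ?F x)) \<in>
      (\<Pi>\<^sub>E i\<in>insert j {..<j}. Bd d R \<times> space (answer_space d p))"
    using h by (intro PiE_fun_upd)
      (auto simp: transcript_space_def space_PiM space_pair_measure space_restrict_space)
  then show ?case
    by (simp add: transcript_space_def space_PiM space_pair_measure space_restrict_space
        Let_def h_def x_def lessThan_Suc fun_upd_def)
qed

context
  fixes \<rho> :: "real \<Rightarrow> real" and p N d n :: nat and L R :: real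
    and Q :: "nat \<Rightarrow> transcript \<Rightarrow> fseq" and out :: "transcript \<Rightarrow> fseq"
  assumes cutoff: "smooth_cutoff \<rho>" and R: "0 < R"
    and alg: "det_algorithm d p (Bd d R) n Q out"
begin

abbreviation (input) hard :: "(nat \<Rightarrow> fseq) \<Rightarrow> fseq \<Rightarrow> fseq" where
  "hard \<equiv> F_op \<rho> p L R N"

text \<open>The output counts as query number \<open>n\<close>, \<open>n + 1\<close>, \dots\<close>

definition point :: "(nat \<Rightarrow> fseq) \<Rightarrow> nat \<Rightarrow> fseq" where
  "point V j = (if j < n then Q j (run d p (hard V) Q j) else out (run d p (hard V) Q n))"

lemma point_in_Bd:
  assumes "V \<in> {1..N + 1} \<rightarrow> Rd d" shows "point V j \<in> Bd d R"
proof -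
  note h = run_in_space[OF cutoff R assms alg]
  have "Q j (run d p (hard V) Q j) \<in> space (restrict_space borel (Bd d R))" if "j < n"
    using that alg h[of j L] unfolding det_algorithm_def
    by (intro measurable_space[of "Q j" "transcript_space d p (Bd d R) j"]) auto
  moreover have "out (run d p (hard V) Q n) \<in> space (restrict_space borel (Bd d R))"
    using alg h[of n L] unfolding det_algorithm_def
    by (intro measurable_space[of out "transcript_space d p (Bd d R) n"]) auto
  ultimately show ?thesis by (simp add: point_def space_restrict_space)
qed

lemma run_Suc_point:
  "j < n \<Longrightarrow> run d p (hard V) Q (Suc j) =
    (run d p (hard V) Q j)(j := (point V j, oracle_answer d p (hard V) (point V j)))"
  by (simp add: point_def Let_def)

text \<open>
  A partial frame \<open>v\<^sub>1, \<dots>, v\<^sub>t\<close>, padded by zeros.  Since \<open>h\<^sub>\<tau>\<close> vanishes near \<open>0\<close>, appending a vector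
  \<open>v\<^sub>t\<^sub>+\<^sub>1\<close> that is orthogonal to the points number \<open>0, \<dots>, t\<close> does not change the answers at the points
  number \<open>0, \<dots>, t - 1\<close>, hence moves none of these \<open>t + 1\<close> points.
\<close>

definition resisting :: "nat \<Rightarrow> (nat \<Rightarrow> fseq) \<Rightarrow> bool" where
  "resisting t V \<longleftrightarrow> orthonormal_frame d t V \<and> (\<forall>i. i \<notin> {1..t} \<longrightarrow> V i = 0) \<and>
     (\<forall>i\<in>{1..t}. \<forall>j<i. V i \<bullet> point V j = 0)"

lemma resisting_in_Rd: "resisting t V \<Longrightarrow> V i \<in> Rd d"
  by (cases "i \<in> {1..t}") (auto simp: resisting_def orthonormal_frame_def)

lemma run_extend:
  assumes V: "resisting t V" and v: "\<And>j. j \<le> t \<Longrightarrow> v \<bullet> point V j = 0"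
  shows "j \<le> t \<Longrightarrow> j \<le> n \<Longrightarrow> run d p (hard (V(t + 1 := v))) Q j = run d p (hard V) Q j"
proof (induction j)
  case (Suc j)
  let ?W = "V(t + 1 := v)"
  have IH: "run d p (hard ?W) Q j = run d p (hard V) Q j"
    by (intro Suc.IH) (use Suc.prems in simp_all)
  then have pt: "point ?W j = point V j" using Suc.prems by (simp add: point_def)
  have "V \<in> {1..N + 1} \<rightarrow> Rd d" using resisting_in_Rd[OF V] by simp
  then have x: "point V j \<in> Rd d" using point_in_Bd[of V j] by (simp add: Bd_iff)
  \<comment> \<open>Only links \<open>t\<close> and \<open>t + 1\<close> differ between the frames.
    Link \<open>t\<close> is silent because j < t; link \<open>t + 1\<close> because
    \<open>v\<close> avoids the point and the old vector is 0.\<close>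
  have Vt: "V t \<bullet> point V j = 0" using V Suc.prems by (simp add: resisting_def)
  have zero: "V i = 0" if "t < i" for i using V that by (simp add: resisting_def)
  have "oracle_answer d p (hard ?W) (point V j) = oracle_answer d p (hard V) (point V j)"
  proof (rule oracle_answer_cong[OF cutoff R x])
    \<comment> \<open>Here \<open>Suc j \<le> t\<close>, so \<open>t \<ge> 1\<close> and the shift
      vector is not the one replaced.\<close>
    show "?W 1 = V 1" using Suc.prems by simp
    fix i assume "i \<in> {1..N}"
    consider "i < t" | "i = t" | "i = t + 1" | "t + 1 < i" by linarith
    then show "?W i = V i \<and> ?W (i + 1) = V (i + 1) \<or>
        ?W i \<bullet> point V j = 0 \<and> V i \<bullet> point V j = 0"
      by cases (use Vt zero v[of j] Suc.prems in auto)
  qed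
  then show ?case using Suc.prems IH pt by (simp only: run_Suc_point Suc_le_eq)
qed simp

text \<open>The new vector must avoid at most t + (t + 1) = 2t + 1 < d vectors.\<close>

lemma resisting_extend:
  assumes V: "resisting t V" and t: "2 * t + 2 \<le> d"
  shows "\<exists>W. resisting (t + 1) W"
proof -
  define A where "A = V ` {1..t} \<union> point V ` {..t}"
  have "card A \<le> card (V ` {1..t}) + card (point V ` {..t})" unfolding A_def by (rule card_Un_le)
  also have "\<dots> \<le> t + (t + 1)"
    using card_image_le[of "{1..t}" V] card_image_le[of "{..t}" "point V"] by (intro add_mono) auto
  finally have "card A < d" using t by simp
  moreover have "finite A" by (simp add: A_def)
  ultimately obtain v where v: "v \<in> Rd d" "norm v = 1" "\<And>a. a \<in> A \<Longrightarrow> v \<bullet> a = 0"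
    using exists_unit_orthogonal[of A d] by blast
  have vx: "v \<bullet> point V j = 0" if "j \<le> t" for j using that v(3) by (simp add: A_def)
  have vV: "v \<bullet> V i = 0" "V i \<bullet> v = 0" if "i \<in> {1..t}" for i
    using that v(3) by (auto simp: A_def inner_commute[of "V i" v])
  have vv: "v \<bullet> v = 1" using v(2) by (simp add: norm_eq_1)
  define W where "W = V(t + 1 := v)"
  have run: "run d p (hard W) Q j = run d p (hard V) Q j" if "j \<le> t" "j \<le> n" for j
    unfolding W_def using run_extend[OF V vx] that by blast
  \<comment> \<open>For j \<ge> n the point is the output, and the run of length n \<le> j \<le> t
    is covered as well.\<close>
  have pt: "point W j = point V j" if "j \<le> t" for j
    using that run[of j] run[of n] by (cases "j < n") (simp_all add: point_def)
  have "orthonormal_frame d (t + 1) W"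
    using V v(1) vV vv by (auto simp: W_def resisting_def orthonormal_frame_def)
  moreover have "\<forall>i. i \<notin> {1..t + 1} \<longrightarrow> W i = 0"
    using V by (auto simp: W_def resisting_def)
  moreover have "W i \<bullet> point W j = 0" if "i \<in> {1..t + 1}" "j < i" for i j
  proof (cases "i = t + 1")
    case True
    then show ?thesis using that vx pt by (simp add: W_def)
  next
    case False
    then have "i \<in> {1..t}" "j \<le> t" using that by auto
    then show ?thesis using V that pt by (simp add: W_def resisting_def)
  qed
  ultimately show ?thesis unfolding resisting_def by blast
qed

lemma resisting_exists: "2 * t \<le> d \<Longrightarrow> \<exists>V. resisting t V"
proof (induction t)
  case 0
  show ?case by (rule exI[of _ "\<lambda>_. 0"]) (simp add: resisting_def orthonormal_frame_def)
next
  case (Suc t)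
  then show ?case using resisting_extend[of t] by auto
qed

text \<open>For n \<le> N the output is point number N, just within reach of the last vector, which
  avoids points 0, ..., N.\<close>

lemma resisting_frame:
  assumes "0 < L" "n \<le> N" "2 * N + 2 \<le> d"
  shows "\<exists>V. orthonormal_frame d (N + 1) V \<and>
    lam_par \<rho> p L R N * R / (8 * real (N + 1)) \<le>
      r_tan d (Bd d R) (hard V) (out (run d p (hard V) Q n))"
proof -
  obtain V where V: "resisting (N + 1) V" using resisting_exists[of "N + 1"] assms(3) by auto
  then have frame: "orthonormal_frame d (N + 1) V" by (simp add: resisting_def)
  have x: "point V N = out (run d p (hard V) Q n)" using assms(2) by (simp add: point_def)
  have "point V N \<in> Bd d R" using resisting_in_Rd[OF V] by (intro point_in_Bd) simp
  moreover have "V (N + 1) \<bullet> point V N = 0" using V by (simp add: resisting_def)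
  ultimately show ?thesis
    using r_tan_ge[OF cutoff R frame assms(1)] frame unfolding x by blast
qed

end

lemma residual_bound_eq:
  assumes "2 \<le> p" "0 < R"
  shows "lam_par \<rho> p L R N * R / (8 * real (N + 1)) =
    L * R ^ p / (8 * B_const \<rho> p * 16 ^ (p - 1) * real (N + 1) powr ((3 * real p - 1) / 2))"
proof -
  define m where "m = real (N + 1)"
  have m: "0 < m" by (simp add: m_def)
  obtain k where p: "p = Suc k" using assms(1) by (cases p) auto
  have tau: "tau_par R N = R / (16 * m powr (3 / 2))"
  proof -
    have "m powr (3 / 2) = m powr (1 + 1 / 2)" by simp
    also have "\<dots> = m * sqrt m" using m by (simp only: powr_add powr_half_sqrt) simp
    finally show ?thesis
      unfolding tau_par_def c_par_def m_def[symmetric] by simp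
  qed
  have "m powr ((3 * real p - 1) / 2) = m powr (3 / 2 * real k + 1)"
    by (simp add: p field_simps)
  also have "\<dots> = (m powr (3 / 2)) ^ k * m"
    using m by (simp only: powr_add powr_powr[symmetric]) (simp add: powr_realpow)
  finally have "m powr ((3 * real p - 1) / 2) = (m powr (3 / 2)) ^ k * m" .
  then show ?thesis
    unfolding m_def[symmetric] lam_par_def tau
    by (simp add: p power_divide power_mult_distrib mult_ac)
qed

section \<open>The complexity bound\<close>

lemma T_det_dominates:
  assumes "smooth_cutoff \<rho>" "2 \<le> p" "0 < L" "0 < D" "T_det p \<epsilon> L D = enat M"
  shows "L * (D / 2) ^ p / (8 * B_const \<rho> p * 16 ^ (p - 1)
      * real (max M 1 + 1) powr ((3 * real p - 1) / 2)) \<le> \<epsilon>"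
proof -
  \<comment> \<open>The hard family is indexed by N \<ge> 1, so a budget of 0 queries is counted as
    1.\<close>
  define N where "N = max M 1"
  define d where "d = 2 * N + 2"
  let ?X = "Bd d (D / 2)"
  define S where "S = {enat N | N.
     \<forall>d X x0. X \<subseteq> Rd d \<and> X \<noteq> {} \<and> compact X \<and> convex X \<and> diameter X \<le> D \<and> x0 \<in> X \<longrightarrow>
       (\<exists>n\<le>N. \<exists>Q out. det_algorithm d p X n Q out \<and>
          (\<forall>F\<in>op_class d p L X. r_tan d X F (out (run d p F Q n)) \<le> \<epsilon>))}"
  have inf: "Inf S = enat M" using assms(5) by (simp add: T_det_def S_def)
  then have "S \<noteq> {}" by (auto simp: Inf_enat_def split: if_splits)
  \<comment> \<open>In a well-order the infimum of a nonempty set is attained, and a finite infimum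
    excludes the empty set.\<close>
  then have "enat M \<in> S" using inf wellorder_InfI[of _ S] by fastforce
  then have "\<forall>d X x0. X \<subseteq> Rd d \<and> X \<noteq> {} \<and> compact X \<and> convex X \<and> diameter X \<le> D \<and> x0 \<in> X \<longrightarrow>
       (\<exists>n\<le>M. \<exists>Q out. det_algorithm d p X n Q out \<and>
          (\<forall>F\<in>op_class d p L X. r_tan d X F (out (run d p F Q n)) \<le> \<epsilon>))"
    unfolding S_def by auto
  moreover have "?X \<subseteq> Rd d" "0 \<in> ?X" "diameter ?X \<le> D"
    using assms(4) diameter_Bd[of "D / 2" d] by (auto simp: Bd_iff)
  ultimately obtain n Q out where n: "n \<le> M" and alg: "det_algorithm d p ?X n Q out"
    and le: "\<And>F. F \<in> op_class d p L ?X \<Longrightarrow> r_tan d ?X F (out (run d p F Q n)) \<le> \<epsilon>"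
    using compact_Bd convex_Bd by (metis empty_iff)
  have D: "0 < D / 2" using assms(4) by simp
  have "n \<le> N" "2 * N + 2 \<le> d" using n by (simp_all add: N_def d_def)
  then obtain V where V: "orthonormal_frame d (N + 1) V"
    "lam_par \<rho> p L (D / 2) N * (D / 2) / (8 * real (N + 1)) \<le>
      r_tan d ?X (F_op \<rho> p L (D / 2) N V) (out (run d p (F_op \<rho> p L (D / 2) N V) Q n))"
    using resisting_frame[OF assms(1) D alg assms(3)] by blast
  have "F_op \<rho> p L (D / 2) N V \<in> op_class d p L ?X"
    using F_op_in_op_class[OF assms(1,3) D assms(2) V(1)] \<open>?X \<subseteq> Rd d\<close> by blast
  from V(2) le[OF this] show ?thesis
    unfolding residual_bound_eq[OF assms(2) D] N_def by linarith
qed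

text \<open>Solving the residual bound for m: with y = L D^p / \<epsilon> it reads y \<le> C
  m^(1/a), that is, k y^a \<le> m \<le> M + 2.\<close>

lemma T_det_lower_bound:
  assumes "2 \<le> p"
  shows "\<exists>c>0. \<exists>K::real. \<forall>L>0. \<forall>D>0. \<forall>\<epsilon>>0. K \<le> L * D ^ p / \<epsilon> \<longrightarrow>
    ereal (c * (L * D ^ p / \<epsilon>) powr (2 / (3 * real p - 1))) \<le> ereal_of_enat (T_det p \<epsilon> L D)"
proof -
  obtain \<rho> where \<rho>: "smooth_cutoff \<rho>" using smooth_cutoff_exists by blast
  define a where "a = 2 / (3 * real p - 1)"
  have a: "0 < a" "(3 * real p - 1) / 2 = 1 / a" using assms by (simp_all add: a_def)
  \<comment> \<open>The factor 2^p comes from the radius R = D/2.\<close>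
  define C where "C = 8 * B_const \<rho> p * 16 ^ (p - 1) * 2 ^ p"
  have C: "0 < C" using B_const_ge_1[of \<rho> p] by (simp add: C_def)
  define k where "k = (1 / C) powr a"
  have k: "0 < k" using C by (simp add: k_def)
  \<comment> \<open>Chosen so that (k/2) y^a \<ge> 2 above the threshold; half of k y^a then absorbs
    the 2 in M + 2.\<close>
  define K where "K = (4 / k) powr (1 / a)"
  have "ereal (k / 2 * (L * D ^ p / \<epsilon>) powr a) \<le> ereal_of_enat (T_det p \<epsilon> L D)"
    if pos: "0 < L" "0 < D" "0 < \<epsilon>" and K: "K \<le> L * D ^ p / \<epsilon>" for L D \<epsilon>
  proof (cases "T_det p \<epsilon> L D")
    case (enat M)
    define y where "y = L * D ^ p / \<epsilon>"
    define m where "m = real (max M 1 + 1)"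
    have m: "1 \<le> m" "m \<le> real M + 2" by (auto simp: m_def)
    have y: "0 < y" using pos by (simp add: y_def)
    have "L * (D / 2) ^ p / (8 * B_const \<rho> p * 16 ^ (p - 1) * m powr (1 / a)) \<le> \<epsilon>"
      using T_det_dominates[OF \<rho> assms pos(1,2) enat] by (simp only: a(2) m_def)
    then have "L * D ^ p / (C * m powr (1 / a)) \<le> \<epsilon>"
      by (simp add: C_def power_divide mult_ac)
    then have "1 / C * y \<le> m powr (1 / a)"
      using C m pos by (simp add: y_def field_simps)
    then have "(1 / C * y) powr a \<le> (m powr (1 / a)) powr a"
      using C y a by (intro powr_mono2) auto
    then have "k * y powr a \<le> m"
      using C y a m by (simp add: k_def powr_mult powr_powr powr_divide)
    moreover have "K powr a \<le> y powr a"
      using K a by (intro powr_mono2) (auto simp: y_def K_def)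
    then have "4 / k \<le> y powr a" using a k by (simp add: K_def powr_powr)
    then have "2 \<le> k / 2 * y powr a" using k by (simp add: field_simps)
    ultimately have "k / 2 * y powr a \<le> real M" using m by linarith
    then show ?thesis by (simp add: enat y_def)
  qed simp
  then show ?thesis unfolding a_def using k
    by (intro exI[of _ "k / 2"] conjI exI[of _ K]) auto
qed

theorem theorem11p1:
  shows "(\<forall>\<rho>. smooth_cutoff \<rho> \<longrightarrow>
      (\<forall>(p::nat) (L::real) (R::real) (N::nat) (d::nat) (n::nat) Q out.
         2 \<le> p \<and> 0 < L \<and> 0 < R \<and> 1 \<le> N \<and> 2 * N + 2 \<le> d \<and> n \<le> N \<and>
         det_algorithm d p (Bd d R) n Q out \<longrightarrow>
         (\<exists>V. orthonormal_frame d (N + 1) V \<and>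
            (let F = F_op \<rho> p L R N V in
              r_tan d (Bd d R) F (out (run d p F Q n))
                \<ge> lam_par \<rho> p L R N * R / (8 * real (N + 1)))) \<and>
         lam_par \<rho> p L R N * R / (8 * real (N + 1)) =
           L * R ^ p / (8 * B_const \<rho> p * 16 ^ (p - 1)
                          * real (N + 1) powr ((3 * real p - 1) / 2)))) \<and>
    (\<forall>p::nat. 2 \<le> p \<longrightarrow>
      (\<exists>c>0. \<exists>K::real. \<forall>L>0. \<forall>D>0. \<forall>\<epsilon>>0. K \<le> L * D ^ p / \<epsilon> \<longrightarrow>
         ereal (c * (L * D ^ p / \<epsilon>) powr (2 / (3 * real p - 1)))
           \<le> ereal_of_enat (T_det p \<epsilon> L D)))"
  using resisting_frame residual_bound_eq T_det_lower_bound unfolding Let_def by blast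

end
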